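(* Let $\Gamma$ be finitely generated and virtually $(\mathcal H,F)$-indicable with strong graph height function $h_F$ on $K_\phi$, and let $\phi\in\Phi$ and $\ell\in\Lambda$. (a) For all sufficiently large $c$, the limits $$\mu_{\phi,\ell}=\limsup_{m\to\infty}w_\phi(\sigma_{m,c})^{1/m},\qquad \beta_{\phi,\ell}=\lim_{m\to\infty}w_\phi(\beta_{m,c}(v))^{1/m},\quad v\in\Gamma,$$ exist and are independent of the choice of $c$ (and, for the latter, of the choice of $v$). (b) If $\ell_{\max}:=\sup\{\ell(\gamma):\gamma\in\mathrm{supp}(\phi)\}<\infty$, then the $\limsup$ in the definition of $\mu_{\phi,\ell}$ may be replaced by $\lim$. (c) $0<\beta_{\phi,\ell}\le\mu_{\phi,\ell}\le\max\{1,w(\Gamma)^{1/\ell_{\min}}\}$.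
   Context: $\Gamma$ is virtually $(\mathcal H,F)$-indicable if $\mathcal H\trianglelefteq\Gamma$ has finite index and $F:\mathcal H\to\mathbb Z$ is a surjective homomorphism. $\Phi$: set of $\phi:\Gamma\to[0,\infty)$ with $\phi(\mathrm{id})=0$, $\phi(\gamma^{-1})=\phi(\gamma)$, $w(\Gamma):=\sum_{\gamma}\phi(\gamma)<\infty$, and $\mathrm{supp}(\phi)=\{\gamma:\phi(\gamma)>0\}$ generating $\Gamma$. $K_\phi$: graph on $\Gamma$ with edges $\langle u,v\rangle$, $u^{-1}v\in\mathrm{supp}(\phi)$. A strong graph height function on $K_\phi$ is a pair $(h,\mathcal H)$ with $\mathcal H\trianglelefteq\Gamma$ of finite index acting by left multiplication, $h:\Gamma\to\mathbb Z$, $h(\mathrm{id})=0$, $h(\alpha v)-h(\alpha u)=h(v)-h(u)$ for $\alpha\in\mathcal H$, and every vertex has $K_\phi$-neighbours of strictly smaller and strictly larger height; the paper fixes such a function $(h_F,\mathcal H)$ constructed from $F$. $\Lambda$: set of $\ell:\Gamma\to(0,\infty)$ with $\ell(\gamma^{-1})=\ell(\gamma)$ and $\ell_{\min}:=\inf_\gamma\ell(\gamma)>0$. A self-avoiding walk (SAW) on the complete graph on $\Gamma$ is a sequence $\pi=(\pi_0,\dots,\pi_n)$ of distinct elements; its weight is $w_\phi(\pi)=\prod_{i=1}^n\phi(\pi_{i-1}^{-1}\pi_i)$ and its $\ell$-length is $\ell(\pi)=\sum_{i=1}^n\ell(\pi_{i-1}^{-1}\pi_i)$; $w_\phi(\Pi)=\sum_{\pi\in\Pi}w_\phi(\pi)$.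 A bridge is a SAW with $h_F(\pi_0)<h_F(\pi_i)\le h_F(\pi_n)$ for $1\le i\le n$. For $m\ge0$, $c>0$, $v\in\Gamma$: $\sigma_{m,c}$ is the set of SAWs from $\mathrm{id}$ with $m\le\ell(\pi)<m+c$, and $\beta_{m,c}(v)$ is the set of bridges from $v$ with $m\le\ell(\pi)<m+c$. *)

theory Defs
  imports "HOL-Analysis.Analysis" "HOL-Algebra.Elementary_Groups" "HOL-Algebra.Generated_Groups"
begin

definition finitely_generated_group :: "('a, 'b) monoid_scheme \<Rightarrow> bool" where
  "finitely_generated_group G \<longleftrightarrow>
     group G \<and> (\<exists>S. finite S \<and> S \<subseteq> carrier G \<and> generate G S = carrier G)"

definition finite_index :: "('a, 'b) monoid_scheme \<Rightarrow> 'a set \<Rightarrow> bool" where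
  "finite_index G H \<longleftrightarrow> finite (rcosets\<^bsub>G\<^esub> H)"

definition virtually_indicable :: "('a, 'b) monoid_scheme \<Rightarrow> 'a set \<Rightarrow> ('a \<Rightarrow> int) \<Rightarrow> bool" where
  "virtually_indicable G H F \<longleftrightarrow>
     H \<lhd> G \<and> finite_index G H \<and> F \<in> hom (G\<lparr>carrier := H\<rparr>) integer_group \<and> F ` H = UNIV"

definition supp :: "('a, 'b) monoid_scheme \<Rightarrow> ('a \<Rightarrow> real) \<Rightarrow> 'a set" where
  "supp G \<phi> = {\<gamma> \<in> carrier G. \<phi> \<gamma> > 0}"

text \<open>The classes \<open>\<Phi>\<close> and \<open>\<Lambda>\<close>. All functions on the group are constrained on its
  carrier only.\<close>

definition step_weights :: "('a, 'b) monoid_scheme \<Rightarrow> ('a \<Rightarrow> real) set" where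
  "step_weights G =
     {\<phi>. (\<forall>\<gamma>\<in>carrier G. 0 \<le> \<phi> \<gamma>) \<and> \<phi> \<one>\<^bsub>G\<^esub> = 0 \<and>
         (\<forall>\<gamma>\<in>carrier G. \<phi> (inv\<^bsub>G\<^esub> \<gamma>) = \<phi> \<gamma>) \<and>
         \<phi> summable_on carrier G \<and> generate G (supp G \<phi>) = carrier G}"

definition total_weight :: "('a, 'b) monoid_scheme \<Rightarrow> ('a \<Rightarrow> real) \<Rightarrow> real" where
  "total_weight G \<phi> = (\<Sum>\<^sub>\<infinity>\<gamma>\<in>carrier G. \<phi> \<gamma>)"

definition min_length :: "('a, 'b) monoid_scheme \<Rightarrow> ('a \<Rightarrow> real) \<Rightarrow> real" where
  "min_length G l = (INF \<gamma>\<in>carrier G. l \<gamma>)"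

definition step_lengths :: "('a, 'b) monoid_scheme \<Rightarrow> ('a \<Rightarrow> real) set" where
  "step_lengths G =
     {l. (\<forall>\<gamma>\<in>carrier G. 0 < l \<gamma>) \<and>
         (\<forall>\<gamma>\<in>carrier G. l (inv\<^bsub>G\<^esub> \<gamma>) = l \<gamma>) \<and> 0 < min_length G l}"

text \<open>Adjacency in the graph \<open>K\<^sub>\<phi>\<close>.\<close>

definition K_adj :: "('a, 'b) monoid_scheme \<Rightarrow> ('a \<Rightarrow> real) \<Rightarrow> 'a \<Rightarrow> 'a \<Rightarrow> bool" where
  "K_adj G \<phi> u v \<longleftrightarrow>
     u \<in> carrier G \<and> v \<in> carrier G \<and> inv\<^bsub>G\<^esub> u \<otimes>\<^bsub>G\<^esub> v \<in> supp G \<phi>"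

definition strong_graph_height_function ::
    "('a, 'b) monoid_scheme \<Rightarrow> ('a \<Rightarrow> real) \<Rightarrow> ('a \<Rightarrow> int) \<Rightarrow> 'a set \<Rightarrow> bool" where
  "strong_graph_height_function G \<phi> h H \<longleftrightarrow>
     H \<lhd> G \<and> finite_index G H \<and> h \<one>\<^bsub>G\<^esub> = 0 \<and>
     (\<forall>\<alpha>\<in>H. \<forall>u\<in>carrier G. \<forall>v\<in>carrier G.
        h (\<alpha> \<otimes>\<^bsub>G\<^esub> v) - h (\<alpha> \<otimes>\<^bsub>G\<^esub> u) = h v - h u) \<and>
     (\<forall>v\<in>carrier G.
        (\<exists>u. K_adj G \<phi> v u \<and> h u < h v) \<and> (\<exists>w. K_adj G \<phi> v w \<and> h v < h w))"

text \<open>A walk with \<open>n\<close> steps is the list of its \<open>n + 1\<close> vertices.\<close>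

definition saw :: "('a, 'b) monoid_scheme \<Rightarrow> 'a list \<Rightarrow> bool" where
  "saw G \<pi> \<longleftrightarrow> \<pi> \<noteq> [] \<and> set \<pi> \<subseteq> carrier G \<and> distinct \<pi>"

definition walk_weight :: "('a, 'b) monoid_scheme \<Rightarrow> ('a \<Rightarrow> real) \<Rightarrow> 'a list \<Rightarrow> real" where
  "walk_weight G \<phi> \<pi> =
     (\<Prod>i<length \<pi> - 1. \<phi> (inv\<^bsub>G\<^esub> (\<pi> ! i) \<otimes>\<^bsub>G\<^esub> \<pi> ! Suc i))"

definition walk_length :: "('a, 'b) monoid_scheme \<Rightarrow> ('a \<Rightarrow> real) \<Rightarrow> 'a list \<Rightarrow> real" where
  "walk_length G l \<pi> =
     (\<Sum>i<length \<pi> - 1. l (inv\<^bsub>G\<^esub> (\<pi> ! i) \<otimes>\<^bsub>G\<^esub> \<pi> ! Suc i))"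

definition bridge :: "('a, 'b) monoid_scheme \<Rightarrow> ('a \<Rightarrow> int) \<Rightarrow> 'a list \<Rightarrow> bool" where
  "bridge G h \<pi> \<longleftrightarrow> saw G \<pi> \<and>
     (\<forall>i\<in>{1..length \<pi> - 1}. h (hd \<pi>) < h (\<pi> ! i) \<and> h (\<pi> ! i) \<le> h (last \<pi>))"

definition saws_between ::
    "('a, 'b) monoid_scheme \<Rightarrow> ('a \<Rightarrow> real) \<Rightarrow> real \<Rightarrow> real \<Rightarrow> 'a list set" where
  "saws_between G l m c =
     {\<pi>. saw G \<pi> \<and> hd \<pi> = \<one>\<^bsub>G\<^esub> \<and> m \<le> walk_length G l \<pi> \<and> walk_length G l \<pi> < m + c}"

definition bridges_between ::
    "('a, 'b) monoid_scheme \<Rightarrow> ('a \<Rightarrow> int) \<Rightarrow> ('a \<Rightarrow> real) \<Rightarrow> real \<Rightarrow> real \<Rightarrow> 'a \<Rightarrow> 'a list set"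
  where
  "bridges_between G h l m c v =
     {\<pi>. bridge G h \<pi> \<and> hd \<pi> = v \<and> m \<le> walk_length G l \<pi> \<and> walk_length G l \<pi> < m + c}"

text \<open>The value of \<open>infsum\<close> at a non-summable family is \<open>0\<close>; the lemmas
  \<open>summable_saws_between\<close> and \<open>summable_bridges_between\<close> below show that this default
  is never used for the sets of walks above.\<close>

definition walks_weight :: "('a, 'b) monoid_scheme \<Rightarrow> ('a \<Rightarrow> real) \<Rightarrow> 'a list set \<Rightarrow> real" where
  "walks_weight G \<phi> W = (\<Sum>\<^sub>\<infinity>\<pi>\<in>W. walk_weight G \<phi> \<pi>)"

lemma walk_weight_Cons:
  "walk_weight G \<phi> (x # y # \<rho>) = \<phi> (inv\<^bsub>G\<^esub> x \<otimes>\<^bsub>G\<^esub> y) * walk_weight G \<phi> (y # \<rho>)"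
  unfolding walk_weight_def by (simp add: prod.lessThan_Suc_shift del: prod.lessThan_Suc)

lemma walk_weight_nonneg:
  assumes "group G" "\<phi> \<in> step_weights G" "set \<pi> \<subseteq> carrier G"
  shows "0 \<le> walk_weight G \<phi> \<pi>"
proof -
  interpret group G by fact
  have "\<pi> ! i \<in> carrier G" if "i < length \<pi>" for i
    using that assms(3) nth_mem by blast
  then show ?thesis
    using assms(2) unfolding walk_weight_def step_weights_def by (intro prod_nonneg) auto
qed

lemma total_weight_nonneg:
  "\<phi> \<in> step_weights G \<Longrightarrow> 0 \<le> total_weight G \<phi>"
  unfolding total_weight_def step_weights_def by (auto intro: infsum_nonneg)

lemma sum_walk_weight_le:
  assumes G: "group G" and \<phi>: "\<phi> \<in> step_weights G"
  shows "finite S \<Longrightarrow> v \<in> carrier G \<Longrightarrow>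
    (\<And>\<pi>. \<pi> \<in> S \<Longrightarrow> set \<pi> \<subseteq> carrier G \<and> length \<pi> = Suc n \<and> hd \<pi> = v) \<Longrightarrow>
    (\<Sum>\<pi>\<in>S. walk_weight G \<phi> \<pi>) \<le> total_weight G \<phi> ^ n"
proof (induction n arbitrary: S v)
  case 0
  have "S \<subseteq> {[v]}"
  proof
    fix \<pi> assume "\<pi> \<in> S"
    with "0.prems"(3)[of \<pi>] show "\<pi> \<in> {[v]}" by (cases \<pi>) auto
  qed
  then have "S = {} \<or> S = {[v]}" by auto
  then show ?case by (auto simp: walk_weight_def)
next
  case (Suc n)
  interpret group G by fact
  let ?w = "total_weight G \<phi>"
  let ?y = "\<lambda>\<pi>::'a list. hd (tl \<pi>)"
  let ?step = "\<lambda>y. inv\<^bsub>G\<^esub> v \<otimes>\<^bsub>G\<^esub> y"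
  have form: "\<exists>y \<rho>. \<pi> = v # y # \<rho> \<and> y \<in> carrier G \<and> set \<rho> \<subseteq> carrier G \<and> length \<rho> = n"
    if "\<pi> \<in> S" for \<pi>
  proof -
    have p: "set \<pi> \<subseteq> carrier G" "length \<pi> = Suc (Suc n)" "hd \<pi> = v"
      using Suc.prems(3)[OF that] by blast+
    obtain x y \<rho> where "\<pi> = x # y # \<rho>" "length \<rho> = n"
      using p(2) by (metis length_Suc_conv)
    then show ?thesis using p by simp
  qed
  have hd_tl: "hd (tl \<pi>) \<in> carrier G" if "\<pi> \<in> S" for \<pi>
    using form[OF that] by auto
  have Y: "finite (?y ` S)" "?y ` S \<subseteq> carrier G"
    using \<open>finite S\<close> hd_tl by blast+
  have inner: "(\<Sum>\<pi>\<in>{\<pi> \<in> S. ?y \<pi> = y}. walk_weight G \<phi> \<pi>) \<le> \<phi> (?step y) * ?w ^ n"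
    if y: "y \<in> ?y ` S" for y
  proof -
    let ?S = "{\<pi> \<in> S. ?y \<pi> = y}"
    have yc: "y \<in> carrier G" using y Y by auto
    have inj: "inj_on tl ?S"
    proof (rule inj_onI)
      fix a b assume ab: "a \<in> ?S" "b \<in> ?S" "tl a = tl b"
      then have "a \<in> S" "b \<in> S" by auto
      then show "a = b" using form[of a] form[of b] ab(3) by (metis list.sel(3))
    qed
    have "(\<Sum>\<pi>\<in>?S. walk_weight G \<phi> \<pi>) = (\<Sum>\<pi>\<in>?S. \<phi> (?step y) * walk_weight G \<phi> (tl \<pi>))"
    proof (rule sum.cong)
      fix \<pi> assume "\<pi> \<in> ?S"
      then have "\<pi> \<in> S" "?y \<pi> = y" by auto
      moreover from form[OF this(1)] obtain z \<rho> where "\<pi> = v # z # \<rho>" by blast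
      ultimately show "walk_weight G \<phi> \<pi> = \<phi> (?step y) * walk_weight G \<phi> (tl \<pi>)"
        by (simp add: walk_weight_Cons)
    qed simp
    also have "\<dots> = \<phi> (?step y) * (\<Sum>\<rho>\<in>tl ` ?S. walk_weight G \<phi> \<rho>)"
      using inj by (simp add: sum_distrib_left sum.reindex)
    also have "\<dots> \<le> \<phi> (?step y) * ?w ^ n"
    proof (rule mult_left_mono)
      show "(\<Sum>\<rho>\<in>tl ` ?S. walk_weight G \<phi> \<rho>) \<le> ?w ^ n"
      proof (rule Suc.IH[OF _ yc])
        show "finite (tl ` ?S)" using \<open>finite S\<close> by simp
        fix \<rho> assume "\<rho> \<in> tl ` ?S"
        then obtain \<pi> where p: "\<pi> \<in> S" "?y \<pi> = y" "\<rho> = tl \<pi>" by blast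
        then show "set \<rho> \<subseteq> carrier G \<and> length \<rho> = Suc n \<and> hd \<rho> = y"
          using form[OF p(1)] by auto
      qed
      show "0 \<le> \<phi> (?step y)"
        using \<phi> yc Suc.prems(2) by (auto simp: step_weights_def)
    qed
    finally show ?thesis .
  qed
  have injs: "inj_on ?step (?y ` S)"
  proof (rule inj_onI)
    fix a b assume "a \<in> ?y ` S" "b \<in> ?y ` S" "?step a = ?step b"
    moreover then have "a \<in> carrier G" "b \<in> carrier G" using Y(2) by blast+
    ultimately show "a = b" using \<open>v \<in> carrier G\<close> by simp
  qed
  have "(\<Sum>y\<in>?y ` S. \<phi> (?step y)) = (\<Sum>g\<in>?step ` ?y ` S. \<phi> g)"
    using injs by (simp add: sum.reindex)
  also have "\<dots> \<le> ?w"
    unfolding total_weight_def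
  proof (rule finite_sum_le_infsum)
    show "?step ` ?y ` S \<subseteq> carrier G" using hd_tl \<open>v \<in> carrier G\<close> by blast
    show "finite (?step ` ?y ` S)" using Y(1) by simp
  qed (use \<phi> in \<open>auto simp: step_weights_def\<close>)
  finally have stepsum: "(\<Sum>y\<in>?y ` S. \<phi> (?step y)) \<le> ?w" .
  have "(\<Sum>\<pi>\<in>S. walk_weight G \<phi> \<pi>) = (\<Sum>y\<in>?y ` S. \<Sum>\<pi>\<in>{\<pi> \<in> S. ?y \<pi> = y}. walk_weight G \<phi> \<pi>)"
    using \<open>finite S\<close> Y(1) by (intro sum.group[symmetric]) auto
  also have "\<dots> \<le> (\<Sum>y\<in>?y ` S. \<phi> (?step y) * ?w ^ n)"
    by (rule sum_mono) (rule inner)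
  also have "\<dots> = (\<Sum>y\<in>?y ` S. \<phi> (?step y)) * ?w ^ n"
    by (simp add: sum_distrib_right)
  also have "\<dots> \<le> ?w * ?w ^ n"
    using stepsum total_weight_nonneg[OF \<phi>] by (intro mult_right_mono) auto
  finally show ?case by simp
qed

lemma walk_length_ge:
  assumes "group G" "l \<in> step_lengths G" "set \<pi> \<subseteq> carrier G"
  shows "real (length \<pi> - 1) * min_length G l \<le> walk_length G l \<pi>"
proof -
  interpret group G by fact
  have bb: "bdd_below (l ` carrier G)"
    using assms(2) by (intro bdd_belowI[of _ 0]) (auto simp: step_lengths_def less_imp_le)
  have "min_length G l \<le> l (inv\<^bsub>G\<^esub> (\<pi> ! i) \<otimes>\<^bsub>G\<^esub> \<pi> ! Suc i)" if "i < length \<pi> - 1" for i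
  proof -
    have "\<pi> ! i \<in> carrier G" "\<pi> ! Suc i \<in> carrier G"
      using that assms(3) nth_mem[of i \<pi>] nth_mem[of "Suc i" \<pi>] by auto
    then show ?thesis
      unfolding min_length_def by (intro cINF_lower[OF bb]) auto
  qed
  then have "(\<Sum>i<length \<pi> - 1. min_length G l) \<le> walk_length G l \<pi>"
    unfolding walk_length_def by (intro sum_mono) auto
  then show ?thesis by simp
qed

lemma summable_walks_bounded:
  assumes G: "group G" and \<phi>: "\<phi> \<in> step_weights G" and l: "l \<in> step_lengths G"
    and v: "v \<in> carrier G"
  shows "walk_weight G \<phi> summable_on {\<pi>. saw G \<pi> \<and> hd \<pi> = v \<and> walk_length G l \<pi> < L}"
    (is "_ summable_on ?A")
proof (rule nonneg_bdd_above_summable_on)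
  show "0 \<le> walk_weight G \<phi> \<pi>" if "\<pi> \<in> ?A" for \<pi>
    using that walk_weight_nonneg[OF G \<phi>] by (auto simp: saw_def)
  have pos: "0 < min_length G l" using l by (auto simp: step_lengths_def)
  define N where "N = nat \<lceil>L / min_length G l\<rceil>"
  have len: "length \<pi> - 1 \<le> N" if "\<pi> \<in> ?A" for \<pi>
  proof -
    have "real (length \<pi> - 1) * min_length G l < L"
      using that walk_length_ge[OF G l, of \<pi>] by (auto simp: saw_def)
    then have "real (length \<pi> - 1) < L / min_length G l"
      using pos by (simp add: pos_less_divide_eq)
    then show ?thesis unfolding N_def by linarith
  qed
  show "bdd_above (sum (walk_weight G \<phi>) ` {S. S \<subseteq> ?A \<and> finite S})"
  proof (rule bdd_aboveI2)
    fix S assume "S \<in> {S. S \<subseteq> ?A \<and> finite S}"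
    then have S: "S \<subseteq> ?A" "finite S" by auto
    have "(\<Sum>\<pi>\<in>S. walk_weight G \<phi> \<pi>) =
        (\<Sum>n\<le>N. \<Sum>\<pi>\<in>{\<pi> \<in> S. length \<pi> - 1 = n}. walk_weight G \<phi> \<pi>)"
      using S len by (intro sum.group[symmetric]) auto
    also have "\<dots> \<le> (\<Sum>n\<le>N. total_weight G \<phi> ^ n)"
    proof (rule sum_mono)
      fix n
      show "(\<Sum>\<pi>\<in>{\<pi> \<in> S. length \<pi> - 1 = n}. walk_weight G \<phi> \<pi>) \<le> total_weight G \<phi> ^ n"
      proof (rule sum_walk_weight_le[OF G \<phi> _ v])
        fix \<pi> assume p: "\<pi> \<in> {\<pi> \<in> S. length \<pi> - 1 = n}"
        then have "\<pi> \<in> ?A" using S by auto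
        then have "\<pi> \<noteq> []" "set \<pi> \<subseteq> carrier G" "hd \<pi> = v" by (auto simp: saw_def)
        with p show "set \<pi> \<subseteq> carrier G \<and> length \<pi> = Suc n \<and> hd \<pi> = v"
          by (cases \<pi>) auto
      qed (use S in auto)
    qed
    finally show "sum (walk_weight G \<phi>) S \<le> (\<Sum>n\<le>N. total_weight G \<phi> ^ n)" .
  qed
qed

lemma summable_saws_between:
  assumes "group G" "\<phi> \<in> step_weights G" "l \<in> step_lengths G"
  shows "walk_weight G \<phi> summable_on saws_between G l m c"
proof -
  interpret group G by fact
  show ?thesis
    by (rule summable_on_subset_banach[OF summable_walks_bounded[OF assms one_closed, of "m + c"]])
       (auto simp: saws_between_def)
qed

lemma summable_bridges_between:
  assumes "group G" "\<phi> \<in> step_weights G" "l \<in> step_lengths G" "v \<in> carrier G"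
  shows "walk_weight G \<phi> summable_on bridges_between G h l m c v"
  by (rule summable_on_subset_banach[OF summable_walks_bounded[OF assms, of "m + c"]])
     (auto simp: bridges_between_def bridge_def)

end

theory Submission
  imports Defs "HOL-Library.Sublist" "HOL-Real_Asymp.Real_Asymp"
begin

text \<open>Bridges concatenate: a bridge ending at \<open>u\<close> can be continued by a bridge of bounded length
  and of weight bounded below into the coset \<open>H v\<close>, and then by an \<open>H\<close>-translate of any bridge
  from \<open>v\<close>. Repeated continuation steps also push the length into any later window
  of fixed width \<open>c\<close>, at a cost exponential only in the distance travelled. A walk arises from
  boundedly many pairs in this way, since boundedly many of its prefixes have length in a window of
  width \<open>c\<close>. Hence the bridge weights are supermultiplicative up to a constant and a shift, and
  Fekete's argument gives \<open>\<beta>\<close>. Dually, cutting a self-avoiding walk at the first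
  vertex where its length reaches \<open>m\<close> gives submultiplicativity as soon as all steps of positive weight
  have length at most \<open>c\<close>. Independence of \<open>c\<close> for the upper limit follows by covering a
  wide window by finitely many narrow ones.\<close>

section \<open>Roots of almost multiplicative functions\<close>

text \<open>Only elements of \<open>H\<close> shift all heights by a constant, so a bridge starting
  at v can be attached only at a point of the coset \<open>H v\<close>; hence the connecting bridge
  at every junction. Its cost is uniform because, up to translation by \<open>H\<close>, there are
  finitely many starting points. Lengths at a junction are known only approximately, so joined
  windows are wider than the given ones, and extension squeezes them back to width \<open>c\<close>;
  the threshold on \<open>c\<close> is the length of one continuation, so that no window can be
  jumped over. Since \<open>m\<close> is real, Fekete's argument needs a linear bound on logarithms
  instead of finitely many remainders; since the support of \<open>\<phi>\<close> may be infinite,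
  weights are compared through finite subfamilies. The upper bound in (c) arises because a walk of
  length L has at most L / \<open>lmin\<close> steps and the walks with n steps weigh at most w^n,
  where w is the total weight.\<close>

lemma subadditive_quotient_converges:
  fixes f :: "real \<Rightarrow> real"
  assumes "D > 0"
    and sub: "\<And>x y. D \<le> x \<Longrightarrow> D \<le> y \<Longrightarrow> f (x + y) \<le> f x + f y"
    and bound: "\<And>x. D \<le> x \<Longrightarrow> \<bar>f x\<bar> \<le> B * x"
  shows "\<exists>L. ((\<lambda>x. f x / x) \<longlongrightarrow> L) at_top"
proof -
  define L where "L = (INF x\<in>{D..}. f x / x)"
  have bb: "bdd_below ((\<lambda>x. f x / x) ` {D..})"
  proof (rule bdd_belowI2)
    fix x assume "x \<in> {D..}"
    then have "x > 0" "- (B * x) \<le> f x" using \<open>D > 0\<close> bound[of x] by auto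
    then show "- B \<le> f x / x" by (simp add: field_simps)
  qed
  have lower: "L \<le> f x / x" if "D \<le> x" for x
    unfolding L_def using that by (intro cINF_lower[OF bb]) auto
  \<comment> \<open>The remainder \<open>r\<close> is kept at least \<open>D\<close>, because
    subadditivity is available only there.\<close>
  have mult: "f (real n * x + r) \<le> real n * f x + f r" if "D \<le> x" "D \<le> r" for n x r
  proof (induction n)
    case (Suc n)
    have "0 \<le> real n * x" using that \<open>D > 0\<close> by simp
    then have "f (x + (real n * x + r)) \<le> f x + f (real n * x + r)"
      using that by (intro sub) auto
    then show ?case using Suc by (simp add: algebra_simps)
  qed simp
  have "((\<lambda>x. f x / x) \<longlongrightarrow> L) at_top"
  proof (rule order_tendstoI)
    fix a assume "a < L"
    show "eventually (\<lambda>x. a < f x / x) at_top"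
      using eventually_ge_at_top[of D] by eventually_elim (rule less_le_trans[OF \<open>a < L\<close> lower])
  next
    fix a assume a: "L < a"
    then obtain x0 where x0: "D \<le> x0" "f x0 / x0 < a"
      unfolding L_def using cINF_less_iff[OF _ bb, of a] atLeast_iff[of _ D] by (metis atLeast_iff empty_iff order_refl)
    define k where "k = f x0 / x0"
    define M where "M = 2 * x0 * \<bar>k\<bar> + \<bar>B\<bar> * (2 * x0)"
    have "x0 > 0" using x0 \<open>D > 0\<close> by simp
    have key: "f x / x \<le> k + M / x" if x: "2 * x0 \<le> x" for x
    proof -
      \<comment> \<open>One multiple of \<open>x0\<close> fewer than would fit is removed, so the
        remainder \<open>r\<close> lies between \<open>x0\<close> and \<open>2 * x0\<close>: it is
        at least \<open>D\<close>, and its contributions \<open>- (r * k)\<close> and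
        \<open>f r\<close> are bounded by the constant \<open>M\<close>.\<close>
      define n where "n = nat (\<lfloor>x / x0\<rfloor> - 1)"
      define r where "r = x - real n * x0"
      have "2 \<le> x / x0" using x \<open>x0 > 0\<close> by (simp add: field_simps)
      then have "1 \<le> \<lfloor>x / x0\<rfloor> - 1" by linarith
      then have "real n = real_of_int \<lfloor>x / x0\<rfloor> - 1" unfolding n_def by linarith
      then have "real n + 1 \<le> x / x0" "x / x0 < real n + 2" by linarith+
      then have r: "x0 \<le> r" "r < 2 * x0"
        unfolding r_def using \<open>x0 > 0\<close> by (simp_all add: field_simps)
      have 1: "f x \<le> real n * f x0 + f r"
        using mult[of x0 r n] x0 r by (simp add: r_def)
      have 2: "real n * f x0 = (x - r) * k"
        unfolding r_def k_def using \<open>x0 > 0\<close> by simp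
      have "f r \<le> B * r" using bound[of r] r x0 by simp
      also have "\<dots> \<le> \<bar>B\<bar> * (2 * x0)" using r \<open>x0 > 0\<close> by (intro mult_mono) auto
      finally have 3: "f r \<le> \<bar>B\<bar> * (2 * x0)" .
      have "- (r * k) \<le> r * \<bar>k\<bar>"
        using r \<open>x0 > 0\<close> mult_left_mono[OF abs_ge_minus_self, of r k] by simp
      also have "\<dots> \<le> 2 * x0 * \<bar>k\<bar>" using r by (intro mult_right_mono) auto
      finally have "f x \<le> x * k + M" using 1 2 3 by (simp add: M_def left_diff_distrib)
      then have "f x / x \<le> (x * k + M) / x" using x \<open>x0 > 0\<close> by (intro divide_right_mono) auto
      then show ?thesis using x \<open>x0 > 0\<close> by (simp add: add_divide_distrib)
    qed
    have "((\<lambda>x. k + M / x) \<longlongrightarrow> k + 0) at_top"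
      by (intro tendsto_intros real_tendsto_divide_at_top[OF tendsto_const filterlim_ident])
    then have "eventually (\<lambda>x. k + M / x < a) at_top"
      using x0(2) by (intro order_tendstoD) (auto simp: k_def)
    then show "eventually (\<lambda>x. f x / x < a) at_top"
      using eventually_ge_at_top[of "2 * x0"] by eventually_elim (rule le_less_trans[OF key])
  qed
  then show ?thesis by blast
qed

text \<open>A shift costs a factor \<open>(x + d) / x\<close> tending to 1, a constant a term
  tending to 0. Growth rates therefore ignore shifted windows and multiplicative constants.\<close>

lemma tendsto_quotient_shift:
  fixes g :: "real \<Rightarrow> real"
  assumes "((\<lambda>x. g x / x) \<longlongrightarrow> L) at_top"
  shows "((\<lambda>x. (g (x + d) + K) / x) \<longlongrightarrow> L) at_top"
proof -
  have "((\<lambda>x. (x + d) / x) \<longlongrightarrow> 1) at_top"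
  proof (rule Lim_transform_eventually)
    show "((\<lambda>x. 1 + d / x) \<longlongrightarrow> 1) at_top"
      using tendsto_add[OF tendsto_const[of "1::real"]
          real_tendsto_divide_at_top[OF tendsto_const[of d] filterlim_ident]] by simp
    show "eventually (\<lambda>x. 1 + d / x = (x + d) / x) at_top"
      using eventually_gt_at_top[of 0] by eventually_elim (simp add: field_simps)
  qed
  moreover have "((\<lambda>x. g (x + d) / (x + d)) \<longlongrightarrow> L) at_top"
    using filterlim_compose[OF assms filterlim_tendsto_add_at_top[OF tendsto_const[of d] filterlim_ident]]
    by (simp add: add.commute)
  moreover have "((\<lambda>x::real. K / x) \<longlongrightarrow> 0) at_top"
    by (intro real_tendsto_divide_at_top[OF tendsto_const filterlim_ident])
  ultimately have "((\<lambda>x. g (x + d) / (x + d) * ((x + d) / x) + K / x) \<longlongrightarrow> L * 1 + 0) at_top"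
    by (intro tendsto_intros)
  moreover have "eventually (\<lambda>x. g (x + d) / (x + d) * ((x + d) / x) + K / x = (g (x + d) + K) / x) at_top"
    using eventually_gt_at_top[of "max 0 (- d)"]
  proof eventually_elim
    case (elim x)
    then have "g (x + d) / (x + d) * ((x + d) / x) = g (x + d) / x" by simp
    then show ?case by (simp only: add_divide_distrib[of "g (x + d)"])
  qed
  ultimately show ?thesis
    by (simp add: tendsto_cong)
qed

text \<open>The function \<open>g (x - D) + K\<close> absorbs both defects: since (x - D) + (y - D)
  + D = (x + y) - D, it is exactly subadditive beyond \<open>D\<close>.\<close>

lemma almost_subadditive_quotient_converges:
  fixes g :: "real \<Rightarrow> real"
  assumes "D > 0"
    and sub: "\<And>x y. 0 \<le> x \<Longrightarrow> 0 \<le> y \<Longrightarrow> g (x + y + D) \<le> g x + g y + K"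
    and bound: "\<And>x. 0 \<le> x \<Longrightarrow> \<bar>g x\<bar> \<le> B * (x + 1)"
  shows "\<exists>L. ((\<lambda>x. g x / x) \<longlongrightarrow> L) at_top"
proof -
  define f where "f x = g (x - D) + K" for x
  have "\<exists>L. ((\<lambda>x. f x / x) \<longlongrightarrow> L) at_top"
  proof (rule subadditive_quotient_converges[OF \<open>D > 0\<close>])
    show "f (x + y) \<le> f x + f y" if "D \<le> x" "D \<le> y" for x y
      using sub[of "x - D" "y - D"] that by (simp add: f_def algebra_simps)
    show "\<bar>f x\<bar> \<le> (\<bar>B\<bar> + (\<bar>B\<bar> + \<bar>K\<bar>) / D) * x" if "D \<le> x" for x
    proof -
      have "\<bar>f x\<bar> \<le> B * (x - D + 1) + \<bar>K\<bar>"
        using bound[of "x - D"] that by (simp add: f_def)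
      also have "\<dots> \<le> \<bar>B\<bar> * (x + 1) + \<bar>K\<bar>"
        using that \<open>D > 0\<close> by (intro add_mono mult_mono) auto
      also have "\<dots> = \<bar>B\<bar> * x + (\<bar>B\<bar> + \<bar>K\<bar>) * 1" by (simp add: algebra_simps)
      also have "\<dots> \<le> \<bar>B\<bar> * x + (\<bar>B\<bar> + \<bar>K\<bar>) * (x / D)"
        using that \<open>D > 0\<close> by (intro add_left_mono mult_left_mono) auto
      finally show ?thesis by (simp add: algebra_simps add_divide_distrib)
    qed
  qed
  then obtain L where "((\<lambda>x. f x / x) \<longlongrightarrow> L) at_top" by blast
  from tendsto_quotient_shift[OF this, of D "- K"] show ?thesis
    by (auto simp: f_def)
qed

lemma tendsto_powr_inverse_iff:
  fixes a :: "real \<Rightarrow> real"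
  assumes "\<And>x. 0 \<le> x \<Longrightarrow> 0 < a x" "\<beta> > 0"
  shows "((\<lambda>x. a x powr (1 / x)) \<longlongrightarrow> \<beta>) at_top \<longleftrightarrow> ((\<lambda>x. ln (a x) / x) \<longlongrightarrow> ln \<beta>) at_top"
proof -
  have ev: "eventually (\<lambda>x. 0 < a x) at_top"
    using eventually_ge_at_top[of 0] by eventually_elim (use assms in auto)
  show ?thesis
  proof
    assume "((\<lambda>x. a x powr (1 / x)) \<longlongrightarrow> \<beta>) at_top"
    then have "((\<lambda>x. ln (a x powr (1 / x))) \<longlongrightarrow> ln \<beta>) at_top"
      using \<open>\<beta> > 0\<close> by (intro tendsto_intros) auto
    then show "((\<lambda>x. ln (a x) / x) \<longlongrightarrow> ln \<beta>) at_top"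
      by (rule Lim_transform_eventually) (use ev in \<open>eventually_elim, simp add: ln_powr\<close>)
  next
    assume "((\<lambda>x. ln (a x) / x) \<longlongrightarrow> ln \<beta>) at_top"
    then have "((\<lambda>x. exp (ln (a x) / x)) \<longlongrightarrow> exp (ln \<beta>)) at_top"
      by (intro tendsto_intros)
    moreover have "eventually (\<lambda>x. exp (ln (a x) / x) = a x powr (1 / x)) at_top"
      using ev by eventually_elim (simp add: powr_def)
    ultimately show "((\<lambda>x. a x powr (1 / x)) \<longlongrightarrow> \<beta>) at_top"
      using \<open>\<beta> > 0\<close> by (simp add: tendsto_cong)
  qed
qed

lemma submultiplicative_root_converges:
  fixes a :: "real \<Rightarrow> real"
  assumes "D > 0" "C > 0"
    and pos: "\<And>x. 0 \<le> x \<Longrightarrow> 0 < a x"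
    and sub: "\<And>x y. 0 \<le> x \<Longrightarrow> 0 \<le> y \<Longrightarrow> a (x + y + D) \<le> C * a x * a y"
    and bound: "\<And>x. 0 \<le> x \<Longrightarrow> \<bar>ln (a x)\<bar> \<le> B * (x + 1)"
  shows "\<exists>\<beta>>0. ((\<lambda>x. a x powr (1 / x)) \<longlongrightarrow> \<beta>) at_top"
proof -
  have "\<exists>L. ((\<lambda>x. ln (a x) / x) \<longlongrightarrow> L) at_top"
  proof (rule almost_subadditive_quotient_converges[OF \<open>D > 0\<close> _ bound])
    fix x y :: real assume "0 \<le> x" "0 \<le> y"
    then have "0 < a x" "0 < a y" "0 < a (x + y + D)" "a (x + y + D) \<le> C * a x * a y"
      using pos sub \<open>D > 0\<close> by auto
    then have "ln (a (x + y + D)) \<le> ln (C * a x * a y)" using \<open>C > 0\<close> by simp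
    also have "\<dots> = ln (a x) + ln (a y) + ln C"
      using \<open>C > 0\<close> \<open>0 < a x\<close> \<open>0 < a y\<close> by (simp add: ln_mult)
    finally show "ln (a (x + y + D)) \<le> ln (a x) + ln (a y) + ln C" .
  qed
  then obtain L where "((\<lambda>x. ln (a x) / x) \<longlongrightarrow> ln (exp L)) at_top" by auto
  then have "((\<lambda>x. a x powr (1 / x)) \<longlongrightarrow> exp L) at_top"
    using tendsto_powr_inverse_iff[of a "exp L"] pos by simp
  then show ?thesis using exp_gt_zero by blast
qed

text \<open>Reciprocals turn the inequality into a submultiplicative one, and the two-sided bound on
  the logarithm survives the change of sign.\<close>

lemma supermultiplicative_root_converges:
  fixes a :: "real \<Rightarrow> real"
  assumes "D > 0" "C > 0"
    and pos: "\<And>x. 0 \<le> x \<Longrightarrow> 0 < a x"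
    and super: "\<And>x y. 0 \<le> x \<Longrightarrow> 0 \<le> y \<Longrightarrow> a x * a y \<le> C * a (x + y + D)"
    and bound: "\<And>x. 0 \<le> x \<Longrightarrow> \<bar>ln (a x)\<bar> \<le> B * (x + 1)"
  shows "\<exists>\<beta>>0. ((\<lambda>x. a x powr (1 / x)) \<longlongrightarrow> \<beta>) at_top"
proof -
  have "\<exists>\<beta>>0. ((\<lambda>x. inverse (a x) powr (1 / x)) \<longlongrightarrow> \<beta>) at_top"
  proof (rule submultiplicative_root_converges[OF \<open>D > 0\<close> \<open>C > 0\<close>])
    show "0 < inverse (a x)" if "0 \<le> x" for x using pos[OF that] by simp
    show "inverse (a (x + y + D)) \<le> C * inverse (a x) * inverse (a y)" if "0 \<le> x" "0 \<le> y" for x y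
    proof -
      have "0 < a x" "0 < a y" "0 < a (x + y + D)" using that pos \<open>D > 0\<close> by auto
      then have "inverse (a (x + y + D)) * (a x * a y) \<le> C"
        using super[OF that] by (simp add: inverse_eq_divide pos_divide_le_eq)
      then have "inverse (a (x + y + D)) \<le> C / (a x * a y)"
        using \<open>0 < a x\<close> \<open>0 < a y\<close> by (simp add: pos_le_divide_eq)
      then show ?thesis by (simp add: divide_inverse mult.assoc)
    qed
    show "\<bar>ln (inverse (a x))\<bar> \<le> B * (x + 1)" if "0 \<le> x" for x
      using bound[OF that] pos[OF that] by (simp add: ln_inverse)
  qed
  then obtain \<beta> where \<beta>: "\<beta> > 0" "((\<lambda>x. inverse (a x) powr (1 / x)) \<longlongrightarrow> \<beta>) at_top" by blast
  then have lim: "((\<lambda>x. inverse (inverse (a x) powr (1 / x))) \<longlongrightarrow> inverse \<beta>) at_top"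
    by (intro tendsto_intros) auto
  have ev: "eventually (\<lambda>x. inverse (inverse (a x) powr (1 / x)) = a x powr (1 / x)) at_top"
    using eventually_ge_at_top[of 0]
  proof eventually_elim
    case (elim x)
    then show ?case using pos[of x] by (simp add: powr_def ln_inverse exp_minus)
  qed
  show ?thesis
    using tendsto_cong[OF ev] lim \<beta>(1) by (intro exI[of _ "inverse \<beta>"]) auto
qed

text \<open>After logarithms the two comparisons sandwich \<open>ln (b x) / x\<close> between
  shifted copies of \<open>ln (a x) / x\<close>. This transfers a bridge growth rate to another
  start vertex or window width.\<close>

lemma comparable_root_tendsto:
  fixes a b :: "real \<Rightarrow> real"
  assumes "C > 0" "C' > 0" "D \<ge> 0" "D' \<ge> 0" "\<beta> > 0"
    and a: "\<And>x. 0 \<le> x \<Longrightarrow> 0 < a x" and b: "\<And>x. 0 \<le> x \<Longrightarrow> 0 < b x"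
    and ab: "\<And>x. 0 \<le> x \<Longrightarrow> a x \<le> C * b (x + D)"
    and ba: "\<And>x. 0 \<le> x \<Longrightarrow> b x \<le> C' * a (x + D')"
    and lim: "((\<lambda>x. a x powr (1 / x)) \<longlongrightarrow> \<beta>) at_top"
  shows "((\<lambda>x. b x powr (1 / x)) \<longlongrightarrow> \<beta>) at_top"
proof -
  have lim': "((\<lambda>x. ln (a x) / x) \<longlongrightarrow> ln \<beta>) at_top"
    using tendsto_powr_inverse_iff[of a \<beta>] a \<open>\<beta> > 0\<close> lim by blast
  have "((\<lambda>x. ln (b x) / x) \<longlongrightarrow> ln \<beta>) at_top"
  proof (rule tendsto_sandwich)
    show "((\<lambda>x. (ln (a (x + - D)) + - ln C) / x) \<longlongrightarrow> ln \<beta>) at_top"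
      by (rule tendsto_quotient_shift[OF lim'])
    show "((\<lambda>x. (ln (a (x + D')) + ln C') / x) \<longlongrightarrow> ln \<beta>) at_top"
      by (rule tendsto_quotient_shift[OF lim'])
    show "eventually (\<lambda>x. (ln (a (x + - D)) + - ln C) / x \<le> ln (b x) / x) at_top"
      using eventually_gt_at_top[of D]
    proof eventually_elim
      case (elim x)
      then have p: "0 < a (x - D)" "0 < b x" "a (x - D) \<le> C * b x"
        using a[of "x - D"] b[of x] ab[of "x - D"] \<open>D \<ge> 0\<close> by auto
      then have "ln (a (x - D)) \<le> ln (C * b x)" using \<open>C > 0\<close> by simp
      then show ?case
        using p \<open>C > 0\<close> elim \<open>D \<ge> 0\<close> by (intro divide_right_mono) (auto simp: ln_mult)
    qed
    show "eventually (\<lambda>x. ln (b x) / x \<le> (ln (a (x + D')) + ln C') / x) at_top"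
      using eventually_gt_at_top[of 0]
    proof eventually_elim
      case (elim x)
      then have p: "0 < a (x + D')" "0 < b x" "b x \<le> C' * a (x + D')"
        using a[of "x + D'"] b[of x] ba[of x] \<open>D' \<ge> 0\<close> by auto
      then have "ln (b x) \<le> ln (C' * a (x + D'))" using \<open>C' > 0\<close> by simp
      then show ?case
        using p \<open>C' > 0\<close> elim by (intro divide_right_mono) (auto simp: ln_mult)
    qed
  qed
  then show ?thesis using tendsto_powr_inverse_iff[of b \<beta>] b \<open>\<beta> > 0\<close> by blast
qed

section \<open>Comparing infinite sums through finite subsums\<close>

lemma sum_fibre_le:
  fixes g :: "'a \<Rightarrow> real" and w :: "'b \<Rightarrow> real"
  assumes sm: "w summable_on Y" and nn: "\<And>y. y \<in> Y \<Longrightarrow> 0 \<le> w y" and "finite S"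
    and f: "\<And>x. x \<in> S \<Longrightarrow> f x \<in> Y"
    and gw: "\<And>x. x \<in> S \<Longrightarrow> g x \<le> A * w (f x)" and "0 \<le> A"
    and fib: "\<And>y. y \<in> Y \<Longrightarrow> real (card {x \<in> S. f x = y}) \<le> K" and "0 \<le> K"
  shows "sum g S \<le> A * K * infsum w Y"
proof -
  have "sum g S \<le> (\<Sum>x\<in>S. A * w (f x))" by (intro sum_mono gw)
  \<comment> \<open>Grouping by the value of \<open>f\<close> turns the bound on fibres into a
    multiplicity \<open>K\<close>; this serves constructions on walks that are boundedly many to
    one.\<close>
  also have "\<dots> = (\<Sum>y\<in>f ` S. \<Sum>x\<in>{x \<in> S. f x = y}. A * w (f x))"
    using \<open>finite S\<close> by (rule sum.image_gen)
  also have "\<dots> = (\<Sum>y\<in>f ` S. real (card {x \<in> S. f x = y}) * (A * w y))"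
    by (intro sum.cong) auto
  also have "\<dots> \<le> (\<Sum>y\<in>f ` S. K * (A * w y))"
    using f nn fib \<open>0 \<le> A\<close> by (intro sum_mono mult_right_mono) auto
  also have "\<dots> = A * K * sum w (f ` S)" by (simp add: sum_distrib_left mult_ac)
  also have "\<dots> \<le> A * K * infsum w Y"
    using f nn sm \<open>finite S\<close> \<open>0 \<le> A\<close> \<open>0 \<le> K\<close>
    by (intro mult_left_mono finite_sum_le_infsum) auto
  finally show ?thesis .
qed

text \<open>The bound passes to the limit in one factor at a time, so summability of the product
  family never has to be discussed.\<close>

lemma infsum_mult_le:
  fixes f :: "'a \<Rightarrow> real" and g :: "'b \<Rightarrow> real"
  assumes f: "f summable_on X" and g: "g summable_on Y"
    and le: "\<And>S T. finite S \<Longrightarrow> S \<subseteq> X \<Longrightarrow> finite T \<Longrightarrow> T \<subseteq> Y \<Longrightarrow> sum f S * sum g T \<le> B"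
  shows "infsum f X * infsum g Y \<le> B"
proof -
  have 1: "sum f S * infsum g Y \<le> B" if "finite S" "S \<subseteq> X" for S
  proof (rule tendsto_upperbound)
    show "((\<lambda>T. sum f S * sum g T) \<longlongrightarrow> sum f S * infsum g Y) (finite_subsets_at_top Y)"
      by (intro tendsto_intros infsum_tendsto g)
    show "eventually (\<lambda>T. sum f S * sum g T \<le> B) (finite_subsets_at_top Y)"
      by (rule eventually_finite_subsets_at_top_weakI) (rule le[OF that])
  qed simp
  show ?thesis
  proof (rule tendsto_upperbound)
    show "((\<lambda>S. sum f S * infsum g Y) \<longlongrightarrow> infsum f X * infsum g Y) (finite_subsets_at_top X)"
      by (intro tendsto_intros infsum_tendsto f)
    show "eventually (\<lambda>S. sum f S * infsum g Y \<le> B) (finite_subsets_at_top X)"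
      by (rule eventually_finite_subsets_at_top_weakI) (rule 1)
  qed simp
qed

text \<open>Finitely many pairs lie in a finite rectangle, whose sum factors. It will be applied to
  the two parts of a walk that is cut.\<close>

lemma infsum_le_mult:
  fixes f :: "'a \<Rightarrow> real" and g :: "'b \<Rightarrow> real" and w :: "'c \<Rightarrow> real"
  assumes "w summable_on Z" "f summable_on X" "g summable_on Y"
    and nn: "\<And>x. x \<in> X \<Longrightarrow> 0 \<le> f x" "\<And>y. y \<in> Y \<Longrightarrow> 0 \<le> g y"
    and k: "\<And>z. z \<in> Z \<Longrightarrow> p z \<in> X \<and> q z \<in> Y \<and> w z \<le> f (p z) * g (q z)"
    and inj: "inj_on (\<lambda>z. (p z, q z)) Z"
  shows "infsum w Z \<le> infsum f X * infsum g Y"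
proof (rule infsum_le_finite_sums[OF assms(1)])
  fix S assume S: "finite S" "S \<subseteq> Z"
  then have PQ: "finite (p ` S)" "p ` S \<subseteq> X" "finite (q ` S)" "q ` S \<subseteq> Y" using k by auto
  have "sum w S \<le> (\<Sum>z\<in>S. (\<lambda>(x, y). f x * g y) (p z, q z))"
    using k S(2) by (intro sum_mono) auto
  also have "\<dots> = (\<Sum>(x, y)\<in>(\<lambda>z. (p z, q z)) ` S. f x * g y)"
    using inj_on_subset[OF inj S(2)] by (simp add: sum.reindex)
  also have "\<dots> \<le> (\<Sum>(x, y)\<in>p ` S \<times> q ` S. f x * g y)"
  proof (rule sum_mono2)
    fix b assume "b \<in> p ` S \<times> q ` S - (\<lambda>z. (p z, q z)) ` S"
    then have "fst b \<in> X" "snd b \<in> Y" using PQ by auto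
    then show "0 \<le> (case b of (x, y) \<Rightarrow> f x * g y)" using nn by (simp add: case_prod_unfold)
  qed (use PQ in auto)
  also have "\<dots> = sum f (p ` S) * sum g (q ` S)"
    by (simp add: sum_product sum.cartesian_product)
  also have "\<dots> \<le> infsum f X * infsum g Y"
  proof (rule mult_mono)
    show "sum f (p ` S) \<le> infsum f X" "sum g (q ` S) \<le> infsum g Y"
      using PQ assms(2,3) nn by (auto intro!: finite_sum_le_infsum)
    show "0 \<le> infsum f X" by (rule infsum_nonneg[OF nn(1)])
    show "0 \<le> sum g (q ` S)" using PQ nn by (intro sum_nonneg) auto
  qed
  finally show "sum w S \<le> infsum f X * infsum g Y" .
qed

section \<open>Walks and bridges\<close>

text \<open>Loop erasure from the front: if \<open>x\<close> already lies on the path from its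
  successor, everything before that occurrence is dropped.\<close>

lemma rtrancl_distinct_path:
  assumes "(x, y) \<in> r\<^sup>*"
  shows "\<exists>p. distinct (x # p) \<and> last (x # p) = y \<and> successively (\<lambda>a b. (a, b) \<in> r) (x # p)"
  using assms
proof (induction rule: converse_rtrancl_induct)
  case base
  show ?case by (intro exI[of _ "[]"]) simp
next
  case (step x z)
  then obtain p where p: "distinct (z # p)" "last (z # p) = y"
    "successively (\<lambda>a b. (a, b) \<in> r) (z # p)" by blast
  show ?case
  proof (cases "x \<in> set (z # p)")
    case False
    have "successively (\<lambda>a b. (a, b) \<in> r) (x # z # p)" using p(3) step.hyps(1) by simp
    moreover have "distinct (x # z # p)" using False p(1) by simp
    moreover have "last (x # z # p) = y" using p(2) by simp
    ultimately show ?thesis by blast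
  next
    case True
    then obtain q s where "z # p = q @ x # s" by (meson split_list)
    from p[unfolded this] show ?thesis by (intro exI[of _ s]) (simp add: successively_append_iff)
  qed
qed

lemma walk_weight_single [simp]: "walk_weight G \<phi> [v] = 1"
  by (simp add: walk_weight_def)

lemma walk_length_single [simp]: "walk_length G l [v] = 0"
  by (simp add: walk_length_def)

lemma walk_length_Cons:
  "walk_length G l (x # y # \<rho>) = l (inv\<^bsub>G\<^esub> x \<otimes>\<^bsub>G\<^esub> y) + walk_length G l (y # \<rho>)"
  unfolding walk_length_def by (simp add: sum.lessThan_Suc_shift del: sum.lessThan_Suc)

lemma walk_weight_append:
  "\<pi> \<noteq> [] \<Longrightarrow> walk_weight G \<phi> (\<pi> @ \<rho>) = walk_weight G \<phi> \<pi> * walk_weight G \<phi> (last \<pi> # \<rho>)"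
proof (induction \<pi>)
  case (Cons x \<pi>)
  then show ?case by (cases \<pi>) (auto simp: walk_weight_Cons mult.assoc)
qed simp

lemma walk_length_append:
  "\<pi> \<noteq> [] \<Longrightarrow> walk_length G l (\<pi> @ \<rho>) = walk_length G l \<pi> + walk_length G l (last \<pi> # \<rho>)"
proof (induction \<pi>)
  case (Cons x \<pi>)
  then show ?case by (cases \<pi>) (auto simp: walk_length_Cons)
qed simp

lemma bridge_Cons_iff:
  "bridge G h (x # \<rho>) \<longleftrightarrow>
     saw G (x # \<rho>) \<and> (\<forall>y\<in>set \<rho>. h x < h y \<and> h y \<le> h (last (x # \<rho>)))"
proof -
  have "(\<forall>i\<in>{1..length \<rho>}. P ((x # \<rho>) ! i)) \<longleftrightarrow> (\<forall>y\<in>set \<rho>. P y)" for P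
  proof -
    have "(\<forall>i\<in>{1..length \<rho>}. P ((x # \<rho>) ! i)) \<longleftrightarrow> (\<forall>i<length \<rho>. P (\<rho> ! i))"
      unfolding image_Suc_lessThan[symmetric] by auto
    then show ?thesis by (simp add: all_set_conv_all_nth)
  qed
  from this[of "\<lambda>y. h x < h y \<and> h y \<le> h (last (x # \<rho>))"]
  show ?thesis by (simp add: bridge_def)
qed

text \<open>The pieces are disjoint by height: the first stays at or below
  \<open>h (last \<pi>)\<close>, the second lies strictly above. Either piece may be
  trivial.\<close>

lemma bridge_append:
  assumes "bridge G h \<pi>" "bridge G h (last \<pi> # \<rho>)"
  shows "bridge G h (\<pi> @ \<rho>)"
proof -
  obtain x \<sigma> where \<pi>: "\<pi> = x # \<sigma>" using assms(1) by (cases \<pi>) (auto simp: bridge_def saw_def)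
  have le: "h y \<le> h (last \<pi>)" if "y \<in> set \<pi>" for y
    using assms(1) that last_in_set[of \<sigma>] unfolding \<pi> bridge_Cons_iff by fastforce
  have gt: "h (last \<pi>) < h y \<and> h y \<le> h (last (last \<pi> # \<rho>))" if "y \<in> set \<rho>" for y
    using assms(2) that by (auto simp: bridge_Cons_iff)
  have "h (last \<pi>) \<le> h (last (last \<pi> # \<rho>))" using gt[of "last \<rho>"] by auto
  moreover have "last (\<pi> @ \<rho>) = last (last \<pi> # \<rho>)" by simp
  moreover have "h x < h y" if "y \<in> set \<sigma>" for y using assms(1) that by (auto simp: \<pi> bridge_Cons_iff)
  moreover have "distinct (\<pi> @ \<rho>)" "set (\<pi> @ \<rho>) \<subseteq> carrier G"
    using assms le gt by (fastforce simp: bridge_def saw_def)+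
  moreover have "h x \<le> h (last \<pi>)" using le[of x] by (simp add: \<pi>)
  ultimately show ?thesis
    using le gt unfolding \<pi> append_Cons bridge_Cons_iff saw_def
    by (fastforce simp: \<pi>)
qed

section \<open>Translation invariance under the group and under \<open>H\<close>\<close>

locale height_group = group G for G (structure) +
  fixes \<phi> l :: "'a \<Rightarrow> real" and h :: "'a \<Rightarrow> int" and H :: "'a set"
  assumes phi: "\<phi> \<in> step_weights G" and len: "l \<in> step_lengths G"
    and height: "strong_graph_height_function G \<phi> h H"
begin

abbreviation "wt \<equiv> walk_weight G \<phi>"
abbreviation "wlen \<equiv> walk_length G l"
abbreviation "lmin \<equiv> min_length G l"

lemma subgroup_H: "subgroup H G"
  using height by (simp add: strong_graph_height_function_def normal_imp_subgroup)

lemma H_carrier: "a \<in> H \<Longrightarrow> a \<in> carrier G"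
  using subgroup_H by (rule subgroup.mem_carrier)

lemma height_mult:
  assumes "a \<in> H" "x \<in> carrier G"
  shows "h (a \<otimes> x) = h a + h x"
proof -
  have "h (a \<otimes> x) - h (a \<otimes> \<one>) = h x - h \<one>" "h \<one> = 0"
    using height assms unfolding strong_graph_height_function_def by blast+
  then show ?thesis using H_carrier[OF assms(1)] by simp
qed

text \<open>Finite index in terms of right cosets \<open>H #> r\<close> fits the left action: every
  vertex is an \<open>H\<close>-translate of one of finitely many.\<close>

lemma coset_representatives:
  "\<exists>R. finite R \<and> R \<subseteq> carrier G \<and> (\<forall>g\<in>carrier G. \<exists>a\<in>H. \<exists>r\<in>R. g = a \<otimes> r)"
proof -
  have "finite ((\<lambda>a. H #> a) ` carrier G)"
    using height by (simp add: strong_graph_height_function_def finite_index_def RCOSETS_def UNION_singleton_eq_range)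
  then obtain R where R: "R \<subseteq> carrier G" "finite R" "(\<lambda>a. H #> a) ` carrier G = (\<lambda>a. H #> a) ` R"
    using finite_subset_image[OF _ subset_refl] by metis
  have "\<exists>a\<in>H. \<exists>r\<in>R. g = a \<otimes> r" if g: "g \<in> carrier G" for g
  proof -
    obtain r where r: "r \<in> R" "H #> g = H #> r" using R(3) g by blast
    then have "g \<in> H #> r" using rcos_self[OF g subgroup_H] by simp
    then show ?thesis using r by (auto simp: r_coset_def)
  qed
  then show ?thesis using R by blast
qed

lemma lmin_pos: "0 < lmin"
  using len by (simp add: step_lengths_def)

lemma wt_nonneg: "set \<pi> \<subseteq> carrier G \<Longrightarrow> 0 \<le> wt \<pi>"
  by (rule walk_weight_nonneg[OF is_group phi])

lemma length_ge: "set \<pi> \<subseteq> carrier G \<Longrightarrow> real (length \<pi> - 1) * lmin \<le> wlen \<pi>"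
  by (rule walk_length_ge[OF is_group len])

lemma length_nonneg: "set \<pi> \<subseteq> carrier G \<Longrightarrow> 0 \<le> wlen \<pi>"
  using length_ge[of \<pi>] lmin_pos by (meson mult_nonneg_nonneg of_nat_0_le_iff less_imp_le order_trans)

lemma length_ge_lmin:
  assumes "set (x # \<rho>) \<subseteq> carrier G" "\<rho> \<noteq> []"
  shows "lmin \<le> wlen (x # \<rho>)"
proof -
  have "1 * lmin \<le> real (length (x # \<rho>) - 1) * lmin"
    using assms(2) lmin_pos by (intro mult_right_mono) (cases \<rho>, auto)
  then show ?thesis using length_ge[OF assms(1)] by simp
qed

lemma inv_mult_translate:
  assumes "a \<in> carrier G" "x \<in> carrier G" "y \<in> carrier G"
  shows "inv (a \<otimes> x) \<otimes> (a \<otimes> y) = inv x \<otimes> y"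
proof -
  have "inv a \<otimes> (a \<otimes> y) = y" using assms by (simp add: m_assoc[symmetric])
  then show ?thesis using assms by (simp add: inv_mult_group m_assoc)
qed

lemma wt_translate: "a \<in> carrier G \<Longrightarrow> set \<pi> \<subseteq> carrier G \<Longrightarrow> wt (map ((\<otimes>) a) \<pi>) = wt \<pi>"
proof (induction \<pi> rule: induct_list012)
  case (3 x y zs)
  then show ?case by (simp add: walk_weight_Cons inv_mult_translate)
qed (simp_all add: walk_weight_def)

lemma length_translate: "a \<in> carrier G \<Longrightarrow> set \<pi> \<subseteq> carrier G \<Longrightarrow> wlen (map ((\<otimes>) a) \<pi>) = wlen \<pi>"
proof (induction \<pi> rule: induct_list012)
  case (3 x y zs)
  then show ?case by (simp add: walk_length_Cons inv_mult_translate)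
qed (simp_all add: walk_length_def)

lemma inj_translate: "a \<in> carrier G \<Longrightarrow> S \<subseteq> carrier G \<Longrightarrow> inj_on ((\<otimes>) a) S"
  by (auto simp: inj_on_def subset_iff)

lemma saw_translate: "a \<in> carrier G \<Longrightarrow> saw G \<pi> \<Longrightarrow> saw G (map ((\<otimes>) a) \<pi>)"
  unfolding saw_def by (auto simp: distinct_map inj_translate)

lemma bridge_translate:
  assumes "a \<in> H" "bridge G h \<pi>"
  shows "bridge G h (map ((\<otimes>) a) \<pi>)"
proof -
  obtain x \<rho> where \<pi>: "\<pi> = x # \<rho>" using assms(2) by (cases \<pi>) (auto simp: bridge_def saw_def)
  have c: "set (x # \<rho>) \<subseteq> carrier G" using assms(2) by (simp add: \<pi> bridge_def saw_def)
  have "last (a \<otimes> x # map ((\<otimes>) a) \<rho>) = a \<otimes> last (x # \<rho>)" by (simp add: last_map)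
  moreover have "last (x # \<rho>) \<in> carrier G" using c by auto
  ultimately show ?thesis
    using assms saw_translate[OF H_carrier[OF assms(1)], of \<pi>] c
    unfolding \<pi> list.map bridge_Cons_iff by (auto simp: height_mult subset_iff)
qed

section \<open>Connectivity of the graph inside strips of heights\<close>

definition height_steps :: "int set \<Rightarrow> ('a \<times> 'a) set" where
  "height_steps I = {(x, y). K_adj G \<phi> x y \<and> h x \<in> I \<and> h y \<in> I}"

lemma height_steps_mono: "I \<subseteq> J \<Longrightarrow> (x, y) \<in> (height_steps I)\<^sup>* \<Longrightarrow> (x, y) \<in> (height_steps J)\<^sup>*"
  using rtrancl_mono[of "height_steps I" "height_steps J"] by (auto simp: height_steps_def)

lemma K_adj_translate: "a \<in> carrier G \<Longrightarrow> K_adj G \<phi> x y \<Longrightarrow> K_adj G \<phi> (a \<otimes> x) (a \<otimes> y)"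
  by (auto simp: K_adj_def inv_mult_translate)

lemma K_adj_carrier: "K_adj G \<phi> x y \<Longrightarrow> x \<in> carrier G \<and> y \<in> carrier G"
  by (simp add: K_adj_def)

lemma height_steps_translate:
  assumes "a \<in> H" "(x, y) \<in> (height_steps {m..n})\<^sup>*"
  shows "(a \<otimes> x, a \<otimes> y) \<in> (height_steps {h a + m..h a + n})\<^sup>*"
  using assms(2)
proof (induction rule: rtrancl_induct)
  case (step y z)
  then have "(a \<otimes> y, a \<otimes> z) \<in> height_steps {h a + m..h a + n}"
    using K_adj_translate[OF H_carrier[OF assms(1)]] assms(1) K_adj_carrier
    by (fastforce simp: height_steps_def height_mult)
  then show ?case using step.IH by simp
qed simp

lemma supp_inv: "s \<in> supp G \<phi> \<Longrightarrow> inv s \<in> supp G \<phi>"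
  using phi by (auto simp: supp_def step_weights_def)

lemma supp_carrier: "s \<in> supp G \<phi> \<Longrightarrow> s \<in> carrier G"
  by (simp add: supp_def)

lemma connected:
  assumes "x \<in> carrier G" "y \<in> carrier G"
  shows "(x, y) \<in> (height_steps UNIV)\<^sup>*"
proof -
  have adj: "(x, x \<otimes> s) \<in> height_steps UNIV" if "x \<in> carrier G" "s \<in> supp G \<phi>" for x s
    using that supp_carrier by (simp add: height_steps_def K_adj_def m_assoc[symmetric])
  have "g \<in> carrier G \<and> (\<forall>x\<in>carrier G. (x, x \<otimes> g) \<in> (height_steps UNIV)\<^sup>*)" if "g \<in> generate G (supp G \<phi>)" for g
    using that
  proof (induction rule: generate.induct)
    case (eng g1 g2)
    then show ?case by (auto simp: m_assoc[symmetric] intro: rtrancl_trans)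
  qed (use adj supp_inv supp_carrier in auto)
  moreover have "inv x \<otimes> y \<in> generate G (supp G \<phi>)"
    using phi assms by (simp add: step_weights_def)
  ultimately have "(x, x \<otimes> (inv x \<otimes> y)) \<in> (height_steps UNIV)\<^sup>*" using assms by blast
  then show ?thesis using assms by (simp add: m_assoc[symmetric])
qed

lemma connected_bounded:
  assumes "x \<in> carrier G" "y \<in> carrier G"
  shows "\<exists>M::nat. (x, y) \<in> (height_steps {h x - int M..h x + int M})\<^sup>*"
  using connected[OF assms]
proof (induction rule: rtrancl_induct)
  case base
  show ?case by simp
next
  case (step y z)
  then obtain M :: nat where M: "(x, y) \<in> (height_steps {h x - int M..h x + int M})\<^sup>*" by blast
  define N where "N = M + nat \<bar>h y - h x\<bar> + nat \<bar>h z - h x\<bar>"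
  have "(x, y) \<in> (height_steps {h x - int N..h x + int N})\<^sup>*"
    by (rule height_steps_mono[OF _ M]) (auto simp: N_def)
  moreover have "(y, z) \<in> height_steps {h x - int N..h x + int N}"
    using step.hyps(2) by (auto simp: height_steps_def N_def)
  ultimately show ?case by (meson rtrancl.rtrancl_into_rtrancl)
qed

text \<open>Every strictly higher neighbour raises the integer height by at least 1, and an
  ascending path stays between the heights of its ends.\<close>

lemma climb_up:
  assumes "u \<in> carrier G"
  shows "\<exists>y\<in>carrier G. h u + int n \<le> h y \<and> (u, y) \<in> (height_steps {h u..h y})\<^sup>*"
proof (induction n)
  case 0
  show ?case using assms by (intro bexI[of _ u]) auto
next
  case (Suc n)
  then obtain y where y: "y \<in> carrier G" "h u + int n \<le> h y" "(u, y) \<in> (height_steps {h u..h y})\<^sup>*" by blast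
  obtain z where z: "K_adj G \<phi> y z" "h y < h z"
    using height y(1) unfolding strong_graph_height_function_def by blast
  have "(u, y) \<in> (height_steps {h u..h z})\<^sup>*" by (rule height_steps_mono[OF _ y(3)]) (use z in auto)
  moreover have "(y, z) \<in> height_steps {h u..h z}" using y(2) z by (auto simp: height_steps_def)
  ultimately show ?case
    using y z K_adj_carrier[OF z(1)] by (intro bexI[of _ z]) auto
qed

text \<open>The mirror image of \<open>climb_up\<close>: descend from \<open>v\<close> and traverse
  the edges backwards, which symmetry of the support allows.\<close>

lemma climb_to:
  assumes "v \<in> carrier G"
  shows "\<exists>z\<in>carrier G. h z + int n \<le> h v \<and> (z, v) \<in> (height_steps {h z..h v})\<^sup>*"
proof (induction n)
  case 0
  show ?case using assms by (intro bexI[of _ v]) auto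
next
  case (Suc n)
  then obtain y where y: "y \<in> carrier G" "h y + int n \<le> h v" "(y, v) \<in> (height_steps {h y..h v})\<^sup>*" by blast
  obtain z where z: "K_adj G \<phi> y z" "h z < h y"
    using height y(1) unfolding strong_graph_height_function_def by blast
  have c: "inv y \<otimes> z \<in> supp G \<phi>" "z \<in> carrier G" using z by (auto simp: K_adj_def)
  have "inv z \<otimes> y = inv (inv y \<otimes> z)" using c y(1) by (simp add: inv_mult_group)
  then have "K_adj G \<phi> z y" using c y(1) supp_inv by (simp add: K_adj_def)
  then have "(z, y) \<in> height_steps {h z..h v}" using y(2) z(2) by (auto simp: height_steps_def)
  moreover have "(y, v) \<in> (height_steps {h z..h v})\<^sup>*" by (rule height_steps_mono[OF _ y(3)]) (use z in auto)
  ultimately show ?case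
    using y z c by (intro bexI[of _ z]) (auto intro: converse_rtrancl_into_rtrancl)
qed

text \<open>Finitely many pairs of coset representatives share one \<open>M\<close>, and translation
  by \<open>H\<close> moves a path together with its strip. Both ends receive the same translation,
  so the target is prescribed only up to \<open>H\<close>.\<close>

lemma uniform_connection:
  "\<exists>M::nat. \<forall>y\<in>carrier G. \<forall>z\<in>carrier G. \<exists>a\<in>H. (y, a \<otimes> z) \<in> (height_steps {h y - int M..h y + int M})\<^sup>*"
proof -
  obtain R where R: "finite R" "R \<subseteq> carrier G" "\<And>g. g \<in> carrier G \<Longrightarrow> \<exists>a\<in>H. \<exists>r\<in>R. g = a \<otimes> r"
    using coset_representatives by blast
  have "\<forall>(x, y)\<in>R \<times> R. \<exists>M::nat. (x, y) \<in> (height_steps {h x - int M..h x + int M})\<^sup>*"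
    using connected_bounded R(2) by blast
  then obtain m where m: "\<And>x y. x \<in> R \<Longrightarrow> y \<in> R \<Longrightarrow>
      (x, y) \<in> (height_steps {h x - int (m (x, y))..h x + int (m (x, y))})\<^sup>*"
    unfolding case_prod_unfold by (metis (mono_tags, lifting) bchoice SigmaI fst_conv snd_conv)
  define M where "M = (\<Sum>p\<in>R \<times> R. m p)"
  have le: "m (x, y) \<le> M" if "x \<in> R" "y \<in> R" for x y
    unfolding M_def using that R(1) by (intro member_le_sum) auto
  show ?thesis
  proof (intro exI[of _ M] ballI)
    fix y z assume yz: "y \<in> carrier G" "z \<in> carrier G"
    obtain a r where a: "a \<in> H" "r \<in> R" "y = a \<otimes> r" using R(3)[OF yz(1)] by blast
    obtain b s where b: "b \<in> H" "s \<in> R" "z = b \<otimes> s" using R(3)[OF yz(2)] by blast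
    have cr: "a \<in> carrier G" "b \<in> carrier G" "r \<in> carrier G" "s \<in> carrier G"
      using a b R(2) H_carrier by auto
    have "(r, s) \<in> (height_steps {h r - int M..h r + int M})\<^sup>*"
      by (rule height_steps_mono[OF _ m[OF a(2) b(2)]]) (use le[OF a(2) b(2)] in auto)
    from height_steps_translate[OF a(1) this]
    have "(y, a \<otimes> s) \<in> (height_steps {h y - int M..h y + int M})\<^sup>*"
      using a(3) height_mult[OF a(1) cr(3)] by (simp add: algebra_simps)
    moreover have "a \<otimes> s = (a \<otimes> inv b) \<otimes> z" using b(3) cr by (simp add: m_assoc inv_solve_left)
    moreover have "a \<otimes> inv b \<in> H"
      using a(1) b(1) subgroup_H by (simp add: subgroup.m_closed subgroup.m_inv_closed)
    ultimately show "\<exists>a\<in>H. (y, a \<otimes> z) \<in> (height_steps {h y - int M..h y + int M})\<^sup>*" by auto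
  qed
qed

lemma wt_pos: "successively (K_adj G \<phi>) (x # p) \<Longrightarrow> 0 < wt (x # p)"
proof (induction p arbitrary: x)
  case (Cons y p)
  then have "0 < \<phi> (inv x \<otimes> y)" "0 < wt (y # p)" by (auto simp: K_adj_def supp_def)
  then show ?case by (simp add: walk_weight_Cons)
qed simp

text \<open>Climb high above \<open>u\<close>, move at bounded cost to a coset from which one can climb far up to the
  coset of \<open>v\<close>, and erase loops.\<close>

lemma bridge_to_coset:
  assumes u: "u \<in> carrier G" and v: "v \<in> carrier G"
  shows "\<exists>\<rho>. \<rho> \<noteq> [] \<and> bridge G h (u # \<rho>) \<and> 0 < wt (u # \<rho>) \<and> (\<exists>a\<in>H. last (u # \<rho>) = a \<otimes> v)"
proof -
  obtain M :: nat where M: "\<And>y z. y \<in> carrier G \<Longrightarrow> z \<in> carrier G \<Longrightarrow>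
      \<exists>a\<in>H. (y, a \<otimes> z) \<in> (height_steps {h y - int M..h y + int M})\<^sup>*"
    using uniform_connection by blast
  obtain x where x: "K_adj G \<phi> u x" "h u < h x"
    using height u unfolding strong_graph_height_function_def by blast
  obtain y where y: "y \<in> carrier G" "h x + int M \<le> h y" "(x, y) \<in> (height_steps {h x..h y})\<^sup>*"
    using climb_up[of x M] K_adj_carrier[OF x(1)] by blast
  \<comment> \<open>The path linking \<open>y\<close> to the translate of \<open>z\<close> stays
    within \<open>M\<close> of \<open>h y\<close> and may end \<open>M\<close> below it. A further
    ascent of \<open>2 * M\<close> lifts the final vertex at least to \<open>h y + M\<close>, above
    the whole linking path.\<close>
  obtain z where z: "z \<in> carrier G" "h z + int (2 * M) \<le> h v" "(z, v) \<in> (height_steps {h z..h v})\<^sup>*"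
    using climb_to[OF v, of "2 * M"] by blast
  obtain a where a: "a \<in> H" "(y, a \<otimes> z) \<in> (height_steps {h y - int M..h y + int M})\<^sup>*"
    using M[OF y(1) z(1)] by blast
  have "h (a \<otimes> z) \<in> {h y - int M..h y + int M}"
    using a(2) by (cases rule: rtranclE) (auto simp: height_steps_def)
  then have az: "h y - int M \<le> h a + h z" using height_mult[OF a(1) z(1)] by simp
  have ht: "h (a \<otimes> v) = h a + h v" by (rule height_mult[OF a(1) v])
  \<comment> \<open>The strip begins at \<open>h x\<close>, strictly above \<open>h u\<close>, and
    ends at the height of the last vertex; any path inside it, also after loop erasure, satisfies
    the bridge inequalities.\<close>
  define I where "I = {h x..h (a \<otimes> v)}"
  have "(x, y) \<in> (height_steps I)\<^sup>*" by (rule height_steps_mono[OF _ y(3)]) (use az z(2) in \<open>auto simp: I_def ht\<close>)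
  also have "(y, a \<otimes> z) \<in> (height_steps I)\<^sup>*"
    by (rule height_steps_mono[OF _ a(2)]) (use az z(2) y(2) in \<open>auto simp: I_def ht\<close>)
  also have "(a \<otimes> z, a \<otimes> v) \<in> (height_steps I)\<^sup>*"
    by (rule height_steps_mono[OF _ height_steps_translate[OF a(1) z(3)]]) (use az y(2) in \<open>auto simp: I_def ht\<close>)
  finally obtain p where p: "distinct (x # p)" "last (x # p) = a \<otimes> v"
    "successively (\<lambda>a b. (a, b) \<in> height_steps I) (x # p)" using rtrancl_distinct_path by metis
  have hx: "h x \<le> h (a \<otimes> v)" using az z(2) y(2) ht by simp
  have set: "s \<in> carrier G \<and> h s \<in> I" if "s \<in> set q" "successively (\<lambda>a b. (a, b) \<in> height_steps I) (r # q)"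
    for s q r
    using that by (induction q arbitrary: r) (auto simp: height_steps_def K_adj_def)
  have in_I: "s \<in> carrier G \<and> h s \<in> I" if "s \<in> set (x # p)" for s
    using that set[OF _ p(3)] hx K_adj_carrier[OF x(1)] by (auto simp: I_def)
  have "successively (K_adj G \<phi>) (x # p)"
    by (rule successively_mono[OF p(3)]) (auto simp: height_steps_def)
  then have "0 < wt (u # x # p)" using x(1) by (intro wt_pos) simp
  moreover have "bridge G h (u # x # p)"
    unfolding bridge_Cons_iff saw_def using p(1,2) in_I u x(2) by (fastforce simp: I_def)
  moreover have "last (u # x # p) = a \<otimes> v" using p(2) by simp
  ultimately show ?thesis using a(1) by blast
qed

text \<open>Each \<open>u\<close> is an \<open>H\<close>-translate of one of finitely many
  representatives, and translation by \<open>H\<close> preserves bridges, weights, lengths and the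
  coset containing the endpoint.\<close>

lemma bridge_to_coset_uniform:
  assumes v: "v \<in> carrier G"
  shows "\<exists>\<kappa> L. 0 < \<kappa> \<and> \<kappa> \<le> 1 \<and> 0 < L \<and> (\<forall>u\<in>carrier G. \<exists>\<rho>. \<rho> \<noteq> [] \<and> bridge G h (u # \<rho>) \<and>
      \<kappa> \<le> wt (u # \<rho>) \<and> wlen (u # \<rho>) \<le> L \<and> (\<exists>a\<in>H. last (u # \<rho>) = a \<otimes> v))"
proof -
  obtain R where R: "finite R" "R \<subseteq> carrier G" "\<And>g. g \<in> carrier G \<Longrightarrow> \<exists>a\<in>H. \<exists>r\<in>R. g = a \<otimes> r"
    using coset_representatives by blast
  have "\<forall>u\<in>R. \<exists>\<rho>. \<rho> \<noteq> [] \<and> bridge G h (u # \<rho>) \<and> 0 < wt (u # \<rho>) \<and> (\<exists>a\<in>H. last (u # \<rho>) = a \<otimes> v)"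
    using bridge_to_coset[OF _ v] R(2) by blast
  then obtain p where p: "\<And>u. u \<in> R \<Longrightarrow> p u \<noteq> []" "\<And>u. u \<in> R \<Longrightarrow> bridge G h (u # p u)"
    "\<And>u. u \<in> R \<Longrightarrow> 0 < wt (u # p u)" "\<And>u. u \<in> R \<Longrightarrow> \<exists>a\<in>H. last (u # p u) = a \<otimes> v"
    by (metis (no_types, lifting) bchoice)
  define \<kappa> where "\<kappa> = Min (insert 1 ((\<lambda>u. wt (u # p u)) ` R))"
  define L where "L = Max (insert 1 ((\<lambda>u. wlen (u # p u)) ` R))"
  have \<kappa>: "0 < \<kappa>" "\<kappa> \<le> 1" "\<And>u. u \<in> R \<Longrightarrow> \<kappa> \<le> wt (u # p u)"
    unfolding \<kappa>_def using R(1) p(3) by (auto simp: Min_gr_iff intro!: Min_le)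
  have L: "1 \<le> L" "\<And>u. u \<in> R \<Longrightarrow> wlen (u # p u) \<le> L"
    unfolding L_def using R(1) by (auto intro!: Max_ge)
  show ?thesis
  proof (rule exI[of _ \<kappa>], rule exI[of _ L], intro conjI ballI)
    fix u assume "u \<in> carrier G"
    then obtain a r where a: "a \<in> H" "r \<in> R" "u = a \<otimes> r" using R(3) by blast
    obtain b where b: "b \<in> H" "last (r # p r) = b \<otimes> v" using p(4)[OF a(2)] by blast
    define \<rho> where "\<rho> = map ((\<otimes>) a) (p r)"
    have ur: "u # \<rho> = map ((\<otimes>) a) (r # p r)" by (simp add: \<rho>_def a(3))
    have c: "set (r # p r) \<subseteq> carrier G" "a \<in> carrier G" "b \<in> carrier G"
      using p(2)[OF a(2)] H_carrier a(1) b(1) by (auto simp: bridge_def saw_def)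
    have "last (u # \<rho>) = a \<otimes> last (r # p r)" unfolding ur by (rule last_map) simp
    also have "\<dots> = (a \<otimes> b) \<otimes> v" using b(2) c v by (simp add: m_assoc)
    finally have "\<exists>a\<in>H. last (u # \<rho>) = a \<otimes> v"
      using a(1) b(1) subgroup_H by (meson subgroup.m_closed)
    moreover have "\<rho> \<noteq> []" using p(1)[OF a(2)] by (simp add: \<rho>_def)
    moreover have "bridge G h (u # \<rho>)" unfolding ur by (rule bridge_translate[OF a(1) p(2)[OF a(2)]])
    ultimately show "\<exists>\<rho>. \<rho> \<noteq> [] \<and> bridge G h (u # \<rho>) \<and>
      \<kappa> \<le> wt (u # \<rho>) \<and> wlen (u # \<rho>) \<le> L \<and> (\<exists>a\<in>H. last (u # \<rho>) = a \<otimes> v)"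
      using \<kappa>(3)[OF a(2)] L(2)[OF a(2)] wt_translate[OF c(2,1)] length_translate[OF c(2,1)]
      unfolding ur[symmetric] by metis
  qed (use \<kappa>(1,2) L(1) in simp_all)
qed

subsection \<open>Extending and joining bridges\<close>

abbreviation "brw v m c \<equiv> walks_weight G \<phi> (bridges_between G h l m c v)"
abbreviation "sww m c \<equiv> walks_weight G \<phi> (saws_between G l m c)"

text \<open>Prefixes of one walk form a chain in which each strict extension adds at least
  \<open>lmin\<close>, so distinct ones fall into distinct cells of width \<open>lmin\<close>. This
  bounds how many walks are continued to the same longer walk.\<close>

lemma card_prefixes_le:
  assumes S: "\<And>\<pi>. \<pi> \<in> S \<Longrightarrow> prefix \<pi> \<omega> \<and> \<pi> \<noteq> [] \<and> m \<le> wlen \<pi> \<and> wlen \<pi> < m + c"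
    and \<omega>: "set \<omega> \<subseteq> carrier G" and "0 < c"
  shows "real (card S) \<le> c / lmin + 1"
proof -
  define f where "f \<pi> = \<lfloor>(wlen \<pi> - m) / lmin\<rfloor>" for \<pi>
  have less: "f \<pi> < f \<pi>'" if \<pi>: "\<pi> \<in> S" "\<pi>' \<in> S" "prefix \<pi> \<pi>'" "\<pi> \<noteq> \<pi>'" for \<pi> \<pi>'
  proof -
    obtain \<rho> where \<rho>: "\<pi>' = \<pi> @ \<rho>" "\<rho> \<noteq> []" using \<pi>(3,4) by (auto elim!: prefixE)
    have ne: "\<pi> \<noteq> []" using S[OF \<pi>(1)] by simp
    have "set \<pi>' \<subseteq> carrier G" using S[OF \<pi>(2)] \<omega> set_mono_prefix by blast
    then have "lmin \<le> wlen (last \<pi> # \<rho>)"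
      using ne \<rho> by (intro length_ge_lmin) (auto simp: \<rho>(1))
    then have "wlen \<pi> - m + lmin \<le> wlen \<pi>' - m"
      unfolding \<rho>(1) walk_length_append[OF ne] by simp
    then have "(wlen \<pi> - m + lmin) / lmin \<le> (wlen \<pi>' - m) / lmin"
      using lmin_pos by (intro divide_right_mono) auto
    then have "(wlen \<pi> - m) / lmin + 1 \<le> (wlen \<pi>' - m) / lmin"
      using lmin_pos by (simp add: add_divide_distrib)
    then show ?thesis unfolding f_def by linarith
  qed
  have "inj_on f S"
  proof (rule inj_onI, rule ccontr)
    fix \<pi> \<pi>' assume *: "\<pi> \<in> S" "\<pi>' \<in> S" "f \<pi> = f \<pi>'" "\<pi> \<noteq> \<pi>'"
    then have "prefix \<pi> \<pi>' \<or> prefix \<pi>' \<pi>" using S[of \<pi>] S[of \<pi>'] prefix_same_cases by metis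
    then show False using less[of \<pi> \<pi>'] less[of \<pi>' \<pi>] * by auto
  qed
  moreover have "f ` S \<subseteq> {0..\<lfloor>c / lmin\<rfloor>}"
  proof
    fix k assume "k \<in> f ` S"
    then obtain \<pi> where \<pi>: "\<pi> \<in> S" "k = f \<pi>" by blast
    then have "0 \<le> wlen \<pi> - m" "wlen \<pi> - m \<le> c" using S[OF \<pi>(1)] by auto
    then have "0 \<le> (wlen \<pi> - m) / lmin" "(wlen \<pi> - m) / lmin \<le> c / lmin"
      using lmin_pos by (auto intro: divide_right_mono)
    then show "k \<in> {0..\<lfloor>c / lmin\<rfloor>}" unfolding \<pi>(2) f_def by (auto intro: floor_mono)
  qed
  ultimately have "card S \<le> card {0..\<lfloor>c / lmin\<rfloor>}" by (intro card_inj_on_le) auto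
  moreover have "0 \<le> c / lmin" using \<open>0 < c\<close> lmin_pos by simp
  ultimately show ?thesis by simp linarith
qed

lemma bridge_ne: "bridge G h \<pi> \<Longrightarrow> \<pi> \<noteq> []"
  by (simp add: bridge_def saw_def)

lemma bridge_carrier: "bridge G h \<pi> \<Longrightarrow> set \<pi> \<subseteq> carrier G"
  by (simp add: bridge_def saw_def)

lemma last_bridge_carrier: "bridge G h \<pi> \<Longrightarrow> last \<pi> \<in> carrier G"
  using bridge_ne bridge_carrier last_in_set by blast

text \<open>A continuation adds at most \<open>c\<close>, so the window from \<open>T\<close> to
  \<open>T + c\<close> is never jumped over; it adds at least \<open>lmin\<close>, so
  \<open>n\<close> of them cover a deficit of \<open>n * lmin\<close>. Keeping \<open>\<pi>\<close>
  as a prefix makes the construction boundedly many to one.\<close>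

lemma extend_bridge:
  assumes step: "\<And>u. u \<in> carrier G \<Longrightarrow>
      \<exists>\<rho>. \<rho> \<noteq> [] \<and> bridge G h (u # \<rho>) \<and> \<kappa> \<le> wt (u # \<rho>) \<and> wlen (u # \<rho>) \<le> c"
    and \<kappa>: "0 < \<kappa>" "\<kappa> \<le> 1"
  shows "bridge G h \<pi> \<Longrightarrow> T - real n * lmin \<le> wlen \<pi> \<Longrightarrow> wlen \<pi> < T + c \<Longrightarrow>
    \<exists>\<omega>. bridge G h \<omega> \<and> prefix \<pi> \<omega> \<and> \<kappa> ^ n * wt \<pi> \<le> wt \<omega> \<and> T \<le> wlen \<omega> \<and> wlen \<omega> < T + c"
proof (induction n arbitrary: \<pi>)
  case 0
  then show ?case by (intro exI[of _ \<pi>]) auto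
next
  case (Suc n)
  have c: "set \<pi> \<subseteq> carrier G" and ne: "\<pi> \<noteq> []"
    using bridge_carrier[OF Suc.prems(1)] bridge_ne[OF Suc.prems(1)] by auto
  show ?case
  proof (cases "T \<le> wlen \<pi>")
    case True
    have "\<kappa> ^ Suc n * wt \<pi> \<le> 1 * wt \<pi>"
      using \<kappa> wt_nonneg[OF c] by (intro mult_right_mono power_le_one) auto
    then show ?thesis using True Suc.prems by (intro exI[of _ \<pi>]) auto
  next
    case False
    obtain \<rho> where \<rho>: "\<rho> \<noteq> []" "bridge G h (last \<pi> # \<rho>)" "\<kappa> \<le> wt (last \<pi> # \<rho>)"
      "wlen (last \<pi> # \<rho>) \<le> c" using step[OF last_bridge_carrier[OF Suc.prems(1)]] by blast
    have "lmin \<le> wlen (last \<pi> # \<rho>)" using \<rho>(1) bridge_carrier[OF \<rho>(2)] by (intro length_ge_lmin)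
    then have "\<exists>\<omega>. bridge G h \<omega> \<and> prefix (\<pi> @ \<rho>) \<omega> \<and> \<kappa> ^ n * wt (\<pi> @ \<rho>) \<le> wt \<omega> \<and>
        T \<le> wlen \<omega> \<and> wlen \<omega> < T + c"
      using Suc.prems(2) False \<rho>(4) bridge_append[OF Suc.prems(1) \<rho>(2)]
      by (intro Suc.IH) (auto simp: walk_length_append[OF ne] algebra_simps)
    then obtain \<omega> where \<omega>: "bridge G h \<omega>" "prefix (\<pi> @ \<rho>) \<omega>" "\<kappa> ^ n * wt (\<pi> @ \<rho>) \<le> wt \<omega>"
      "T \<le> wlen \<omega>" "wlen \<omega> < T + c" by blast
    have "\<kappa> ^ Suc n * wt \<pi> = \<kappa> ^ n * (wt \<pi> * \<kappa>)" by simp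
    also have "\<dots> \<le> \<kappa> ^ n * (wt \<pi> * wt (last \<pi> # \<rho>))"
      using \<kappa> \<rho>(3) wt_nonneg[OF c] by (intro mult_left_mono) auto
    also have "\<dots> \<le> wt \<omega>" using \<omega>(3) by (simp add: walk_weight_append[OF ne])
    finally show ?thesis using \<omega> append_prefixD by blast
  qed
qed

text \<open>The tool for changing windows: it shifts them and squeezes any width \<open>c1\<close>
  into width \<open>c\<close>. The factor \<open>c1 / lmin + 1\<close> bounds the number of prefixes
  from which one extended bridge can arise; the threshold is the uniform length of a
  continuation.\<close>

lemma bridges_extend:
  "\<exists>c\<^sub>0>0. \<exists>\<kappa>>0. \<kappa> \<le> 1 \<and> (\<forall>c\<ge>c\<^sub>0. \<forall>c1>0. \<forall>v\<in>carrier G. \<forall>m T n.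
     m + c1 \<le> T + c \<longrightarrow> T - real n * lmin \<le> m \<longrightarrow>
     brw v m c1 \<le> (1 / \<kappa>) ^ n * (c1 / lmin + 1) * brw v T c)"
proof -
  \<comment> \<open>Only weight and length of the continuations matter here, so the target coset can
    be fixed as that of \<open>\<one>\<close>.\<close>
  obtain \<kappa> L where \<kappa>: "0 < \<kappa>" "\<kappa> \<le> 1" "0 < L" and step: "\<And>u. u \<in> carrier G \<Longrightarrow>
      \<exists>\<rho>. \<rho> \<noteq> [] \<and> bridge G h (u # \<rho>) \<and> \<kappa> \<le> wt (u # \<rho>) \<and> wlen (u # \<rho>) \<le> L"
    using bridge_to_coset_uniform[OF one_closed] by metis
  have "brw v m c1 \<le> (1 / \<kappa>) ^ n * (c1 / lmin + 1) * brw v T c"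
    if v: "v \<in> carrier G" and c: "L \<le> c" "0 < c1" "m + c1 \<le> T + c" "T - real n * lmin \<le> m"
    for c c1 v m T n
  proof -
    let ?X = "bridges_between G h l m c1 v" and ?Y = "bridges_between G h l T c v"
    have step': "\<exists>\<rho>. \<rho> \<noteq> [] \<and> bridge G h (u # \<rho>) \<and> \<kappa> \<le> wt (u # \<rho>) \<and> wlen (u # \<rho>) \<le> c"
      if "u \<in> carrier G" for u using step[OF that] c(1) by (meson order_trans)
    have "\<exists>\<omega>\<in>?Y. prefix \<pi> \<omega> \<and> \<kappa> ^ n * wt \<pi> \<le> wt \<omega>" if \<pi>: "\<pi> \<in> ?X" for \<pi>
    proof -
      have b: "bridge G h \<pi>" "T - real n * lmin \<le> wlen \<pi>" "wlen \<pi> < T + c" "hd \<pi> = v"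
        using \<pi> c by (auto simp: bridges_between_def)
      obtain \<omega> where \<omega>: "bridge G h \<omega>" "prefix \<pi> \<omega>" "\<kappa> ^ n * wt \<pi> \<le> wt \<omega>"
        "T \<le> wlen \<omega>" "wlen \<omega> < T + c" using extend_bridge[OF step' \<kappa>(1,2) b(1-3)] by blast
      have "hd \<omega> = v" using \<omega>(2) b(4) bridge_ne[OF b(1)] by (auto elim!: prefixE)
      then show ?thesis using \<omega> by (auto simp: bridges_between_def)
    qed
    then obtain f where f: "\<And>\<pi>. \<pi> \<in> ?X \<Longrightarrow> f \<pi> \<in> ?Y" "\<And>\<pi>. \<pi> \<in> ?X \<Longrightarrow> prefix \<pi> (f \<pi>)"
      "\<And>\<pi>. \<pi> \<in> ?X \<Longrightarrow> \<kappa> ^ n * wt \<pi> \<le> wt (f \<pi>)" by metis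
    note sX = summable_bridges_between[OF is_group phi len v, of h m c1]
    note sY = summable_bridges_between[OF is_group phi len v, of h T c]
    show ?thesis unfolding walks_weight_def
    proof (rule infsum_le_finite_sums[OF sX])
      fix S assume S: "finite S" "S \<subseteq> ?X"
      show "sum wt S \<le> (1 / \<kappa>) ^ n * (c1 / lmin + 1) * infsum wt ?Y"
      proof (rule sum_fibre_le[OF sY _ S(1)])
        show "0 \<le> wt y" if "y \<in> ?Y" for y
          using that by (intro wt_nonneg bridge_carrier) (auto simp: bridges_between_def)
        show "f x \<in> ?Y" "wt x \<le> (1 / \<kappa>) ^ n * wt (f x)" if "x \<in> S" for x
          using f(1,3)[of x] that S(2) \<kappa>(1)
          by (auto simp: power_one_over pos_le_divide_eq mult.commute)
        show "real (card {x \<in> S. f x = y}) \<le> c1 / lmin + 1" if y: "y \<in> ?Y" for y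
        proof (rule card_prefixes_le[OF _ _ c(2)])
          show "set y \<subseteq> carrier G" using y by (auto simp: bridges_between_def intro: subsetD[OF bridge_carrier])
          fix \<pi> assume "\<pi> \<in> {x \<in> S. f x = y}"
          then have "\<pi> \<in> ?X" "f \<pi> = y" using S(2) by auto
          then show "prefix \<pi> y \<and> \<pi> \<noteq> [] \<and> m \<le> wlen \<pi> \<and> wlen \<pi> < m + c1"
            using f(2)[of \<pi>] bridge_ne by (auto simp: bridges_between_def)
        qed
      qed (use \<kappa> c lmin_pos in auto)
    qed
  qed
  then show ?thesis using \<kappa> by blast
qed

text \<open>The connecting bridge and the translation are chosen as functions of the endpoint of the
  first bridge. The joined walk then determines the second bridge once the first is known, and the
  first is one of boundedly many prefixes. The extra width \<open>L\<close> is the uncertainty in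
  the connecting length.\<close>

lemma bridges_join:
  assumes v: "v \<in> carrier G"
  shows "\<exists>\<kappa>>0. \<exists>L>0. \<forall>u\<in>carrier G. \<forall>m n. \<forall>c1>0. \<forall>c2>0.
    brw u m c1 * brw v n c2 \<le> 1 / \<kappa> * (c1 / lmin + 1) * brw u (m + n) (c1 + c2 + L)"
proof -
  obtain \<kappa> L where \<kappa>: "0 < \<kappa>" "0 < L" and step: "\<And>u. u \<in> carrier G \<Longrightarrow>
      \<exists>\<rho>. \<rho> \<noteq> [] \<and> bridge G h (u # \<rho>) \<and> \<kappa> \<le> wt (u # \<rho>) \<and> wlen (u # \<rho>) \<le> L \<and>
        (\<exists>a\<in>H. last (u # \<rho>) = a \<otimes> v)"
    using bridge_to_coset_uniform[OF v] by metis
  obtain \<rho> where \<rho>: "\<And>u. u \<in> carrier G \<Longrightarrow> \<rho> u \<noteq> []" "\<And>u. u \<in> carrier G \<Longrightarrow> bridge G h (u # \<rho> u)"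
    "\<And>u. u \<in> carrier G \<Longrightarrow> \<kappa> \<le> wt (u # \<rho> u)" "\<And>u. u \<in> carrier G \<Longrightarrow> wlen (u # \<rho> u) \<le> L"
    "\<And>u. u \<in> carrier G \<Longrightarrow> \<exists>a\<in>H. last (u # \<rho> u) = a \<otimes> v" using step by metis
  obtain a where a: "\<And>u. u \<in> carrier G \<Longrightarrow> a u \<in> H"
    "\<And>u. u \<in> carrier G \<Longrightarrow> last (u # \<rho> u) = a u \<otimes> v" using \<rho>(5) by metis
  define f where "f = (\<lambda>(\<pi>, \<pi>'). (\<pi> @ \<rho> (last \<pi>)) @ map ((\<otimes>) (a (last \<pi>))) (tl \<pi>'))"
  have "brw u m c1 * brw v n c2 \<le> 1 / \<kappa> * (c1 / lmin + 1) * brw u (m + n) (c1 + c2 + L)"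
    if u: "u \<in> carrier G" and c: "0 < c1" "0 < c2" for u m n c1 c2
  proof -
    let ?X = "bridges_between G h l m c1 u" and ?Z = "bridges_between G h l n c2 v"
    let ?Y = "bridges_between G h l (m + n) (c1 + c2 + L) u"
    note sX = summable_bridges_between[OF is_group phi len u, of h m c1]
    note sZ = summable_bridges_between[OF is_group phi len v, of h n c2]
    note sY = summable_bridges_between[OF is_group phi len u, of h "m + n" "c1 + c2 + L"]
    have join: "f (\<pi>, \<pi>') \<in> ?Y \<and> wt \<pi> * wt \<pi>' \<le> 1 / \<kappa> * wt (f (\<pi>, \<pi>'))"
      if \<pi>: "\<pi> \<in> ?X" "\<pi>' \<in> ?Z" for \<pi> \<pi>'
    proof -
      have b: "bridge G h \<pi>" "hd \<pi> = u" "m \<le> wlen \<pi>" "wlen \<pi> < m + c1"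
        "bridge G h \<pi>'" "hd \<pi>' = v" "n \<le> wlen \<pi>'" "wlen \<pi>' < n + c2"
        using \<pi> by (auto simp: bridges_between_def)
      define x where "x = last \<pi>"
      define \<sigma> where "\<sigma> = \<pi> @ \<rho> x"
      define \<tau> where "\<tau> = map ((\<otimes>) (a x)) (tl \<pi>')"
      have x: "x \<in> carrier G" unfolding x_def by (rule last_bridge_carrier[OF b(1)])
      have ne: "\<pi> \<noteq> []" "\<pi>' \<noteq> []" "\<sigma> \<noteq> []" using bridge_ne b by (auto simp: \<sigma>_def)
      have \<sigma>: "bridge G h \<sigma>"
        unfolding \<sigma>_def using bridge_append[OF b(1)] \<rho>(2)[OF x] by (simp add: x_def)
      have "last \<sigma> = a x \<otimes> v" using a(2)[OF x] \<rho>(1)[OF x] by (simp add: \<sigma>_def)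
      then have \<tau>: "last \<sigma> # \<tau> = map ((\<otimes>) (a x)) \<pi>'"
        using ne(2) b(6) by (cases \<pi>') (auto simp: \<tau>_def)
      have bf: "bridge G h (\<sigma> @ \<tau>)"
        using \<tau> bridge_translate[OF a(1)[OF x] b(5)] by (intro bridge_append[OF \<sigma>]) simp
      have f: "f (\<pi>, \<pi>') = \<sigma> @ \<tau>" by (simp add: f_def \<sigma>_def \<tau>_def x_def)
      have hc: "a x \<in> carrier G" using a(1)[OF x] by (rule H_carrier)
      have w: "wt (\<sigma> @ \<tau>) = wt \<pi> * wt (x # \<rho> x) * wt \<pi>'"
        using walk_weight_append[OF ne(3), of G \<phi> \<tau>] walk_weight_append[OF ne(1), of G \<phi> "\<rho> x"]
          wt_translate[OF hc bridge_carrier[OF b(5)]]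
        by (simp only: \<tau> \<sigma>_def[symmetric] x_def[symmetric])
      have wl: "wlen (\<sigma> @ \<tau>) = wlen \<pi> + wlen (x # \<rho> x) + wlen \<pi>'"
        using walk_length_append[OF ne(3), of G l \<tau>] walk_length_append[OF ne(1), of G l "\<rho> x"]
          length_translate[OF hc bridge_carrier[OF b(5)]]
        by (simp only: \<tau> \<sigma>_def[symmetric] x_def[symmetric])
      have "0 \<le> wlen (x # \<rho> x)" by (rule length_nonneg[OF bridge_carrier[OF \<rho>(2)[OF x]]])
      moreover have "hd (\<sigma> @ \<tau>) = u" using b(2) ne(1) by (simp add: \<sigma>_def)
      ultimately have "f (\<pi>, \<pi>') \<in> ?Y"
        using bf b \<rho>(4)[OF x] unfolding f bridges_between_def by (simp add: wl)
      moreover have "\<kappa> * (wt \<pi> * wt \<pi>') \<le> wt (x # \<rho> x) * (wt \<pi> * wt \<pi>')"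
        using \<rho>(3)[OF x] wt_nonneg[OF bridge_carrier[OF b(1)]] wt_nonneg[OF bridge_carrier[OF b(5)]]
        by (intro mult_right_mono) auto
      ultimately show ?thesis using \<kappa>(1) by (simp add: f w field_simps)
    qed
    have "infsum wt ?X * infsum wt ?Z \<le> 1 / \<kappa> * (c1 / lmin + 1) * infsum wt ?Y"
    proof (rule infsum_mult_le[OF sX sZ])
      fix S T assume S: "finite S" "S \<subseteq> ?X" and T: "finite T" "T \<subseteq> ?Z"
      have "sum wt S * sum wt T = (\<Sum>(\<pi>, \<pi>')\<in>S \<times> T. wt \<pi> * wt \<pi>')"
        by (simp add: sum_product sum.cartesian_product)
      also have "\<dots> \<le> 1 / \<kappa> * (c1 / lmin + 1) * infsum wt ?Y"
      proof (rule sum_fibre_le[OF sY])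
        show "0 \<le> wt y" if "y \<in> ?Y" for y
          using that by (intro wt_nonneg bridge_carrier) (auto simp: bridges_between_def)
        show "f p \<in> ?Y" "(case p of (\<pi>, \<pi>') \<Rightarrow> wt \<pi> * wt \<pi>') \<le> 1 / \<kappa> * wt (f p)" if "p \<in> S \<times> T" for p
        proof -
          obtain \<pi> \<pi>' where p: "p = (\<pi>, \<pi>')" "\<pi> \<in> ?X" "\<pi>' \<in> ?Z" using \<open>p \<in> S \<times> T\<close> S(2) T(2) by auto
          show "f p \<in> ?Y" "(case p of (\<pi>, \<pi>') \<Rightarrow> wt \<pi> * wt \<pi>') \<le> 1 / \<kappa> * wt (f p)"
            using join[OF p(2,3)] by (simp_all add: p(1))
        qed
        show "real (card {p \<in> S \<times> T. f p = y}) \<le> c1 / lmin + 1" if y: "y \<in> ?Y" for y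
        proof -
          let ?P = "{p \<in> S \<times> T. f p = y}"
          \<comment> \<open>With equal first components, cancelling the common prefix and the
            injective translation recovers the second bridge up to its head, which is
            \<open>v\<close>.\<close>
          have "inj_on fst ?P"
          proof (rule inj_onI)
            fix p q assume pq: "p \<in> ?P" "q \<in> ?P" "fst p = fst q"
            obtain \<pi> \<pi>1 \<pi>2 where e: "p = (\<pi>, \<pi>1)" "q = (\<pi>, \<pi>2)" using pq(3) by (cases p, cases q) auto
            have m: "\<pi> \<in> ?X" "\<pi>1 \<in> ?Z" "\<pi>2 \<in> ?Z" "f (\<pi>, \<pi>1) = f (\<pi>, \<pi>2)"
              using pq S(2) T(2) by (auto simp: e)
            have br: "bridge G h \<pi>" "bridge G h \<pi>1" "bridge G h \<pi>2" "hd \<pi>1 = hd \<pi>2"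
              using m by (auto simp: bridges_between_def)
            have ac: "a (last \<pi>) \<in> carrier G" by (intro H_carrier a(1) last_bridge_carrier br(1))
            have "map ((\<otimes>) (a (last \<pi>))) (tl \<pi>1) = map ((\<otimes>) (a (last \<pi>))) (tl \<pi>2)"
              using m(4) by (simp add: f_def)
            moreover have "set (tl \<pi>1) \<union> set (tl \<pi>2) \<subseteq> carrier G"
              using bridge_carrier[OF br(2)] bridge_carrier[OF br(3)] by (cases \<pi>1; cases \<pi>2) auto
            ultimately have "tl \<pi>1 = tl \<pi>2"
              using inj_on_map_eq_map[OF inj_translate[OF ac]] by metis
            then have "\<pi>1 = \<pi>2" using br(4) bridge_ne[OF br(2)] bridge_ne[OF br(3)] by (metis list.collapse)
            then show "p = q" by (simp add: e)
          qed
          then have "card ?P = card (fst ` ?P)" by (rule card_image[symmetric])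
          also have "real (card (fst ` ?P)) \<le> c1 / lmin + 1"
          proof (rule card_prefixes_le[OF _ _ c(1)])
            show "set y \<subseteq> carrier G" using y by (auto simp: bridges_between_def intro: subsetD[OF bridge_carrier])
            fix \<pi> assume "\<pi> \<in> fst ` ?P"
            then obtain \<pi>' where "\<pi> \<in> ?X" "f (\<pi>, \<pi>') = y" using S(2) by auto
            then show "prefix \<pi> y \<and> \<pi> \<noteq> [] \<and> m \<le> wlen \<pi> \<and> wlen \<pi> < m + c1"
              using bridge_ne by (auto simp: bridges_between_def f_def)
          qed
          finally show ?thesis .
        qed
      qed (use \<kappa> c lmin_pos S T in auto)
      finally show "sum wt S * sum wt T \<le> 1 / \<kappa> * (c1 / lmin + 1) * infsum wt ?Y" .
    qed
    then show ?thesis by (simp only: walks_weight_def)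
  qed
  then show ?thesis using \<kappa> by blast
qed

section \<open>Monotonicity and a priori bounds for weights of walks\<close>

lemma walks_weight_mono:
  assumes "V \<subseteq> W" "W \<subseteq> {\<pi>. saw G \<pi> \<and> hd \<pi> = v \<and> wlen \<pi> < L}" "v \<in> carrier G"
  shows "walks_weight G \<phi> V \<le> walks_weight G \<phi> W"
proof -
  \<comment> \<open>Without summability \<open>infsum\<close> would default to 0 and monotonicity
    could fail; the length bound \<open>L\<close> excludes this.\<close>
  have s: "wt summable_on U" if "U \<subseteq> W" for U
    using summable_on_subset_banach[OF summable_walks_bounded[OF is_group phi len assms(3)]] that assms(2)
    by (meson order_trans)
  show ?thesis unfolding walks_weight_def
  proof (rule infsum_mono_neutral[OF s[OF assms(1)] s[OF subset_refl]])
    fix x assume "x \<in> W - V"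
    then show "0 \<le> wt x" using assms(2) by (intro wt_nonneg) (auto simp: saw_def)
  qed (use assms(1) in auto)
qed

text \<open>A walk of length below \<open>L\<close> has at most \<open>N\<close> steps; each step
  count \<open>n\<close> contributes at most \<open>total_weight G \<phi> ^ n\<close>. The maximum
  with 1 covers total weights below 1, whose powers decrease.\<close>

lemma walks_weight_le:
  assumes "v \<in> carrier G" and W: "W \<subseteq> {\<pi>. saw G \<pi> \<and> hd \<pi> = v \<and> wlen \<pi> < L}"
  defines "N \<equiv> nat \<lfloor>L / lmin\<rfloor>"
  shows "walks_weight G \<phi> W \<le> real (N + 1) * max 1 (total_weight G \<phi>) ^ N"
  unfolding walks_weight_def
proof (rule infsum_le_finite_sums)
  show "wt summable_on W"
    using summable_on_subset_banach[OF summable_walks_bounded[OF is_group phi len assms(1)] W] .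
  have len: "length \<pi> - 1 \<le> N" if "\<pi> \<in> W" for \<pi>
  proof -
    have "real (length \<pi> - 1) * lmin < L"
      using that W length_ge[of \<pi>] by (fastforce simp: saw_def)
    then have "real (length \<pi> - 1) < L / lmin" using lmin_pos by (simp add: pos_less_divide_eq)
    then show ?thesis unfolding N_def by linarith
  qed
  fix S assume S: "finite S" "S \<subseteq> W"
  have "sum wt S = (\<Sum>n\<le>N. \<Sum>\<pi>\<in>{\<pi> \<in> S. length \<pi> - 1 = n}. wt \<pi>)"
    using S len by (intro sum.group[symmetric]) auto
  also have "\<dots> \<le> (\<Sum>n\<le>N. max 1 (total_weight G \<phi>) ^ N)"
  proof (rule sum_mono)
    fix n assume n: "n \<in> {..N}"
    have "(\<Sum>\<pi>\<in>{\<pi> \<in> S. length \<pi> - 1 = n}. wt \<pi>) \<le> total_weight G \<phi> ^ n"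
    proof (rule sum_walk_weight_le[OF is_group phi _ assms(1)])
      fix \<pi> assume p: "\<pi> \<in> {\<pi> \<in> S. length \<pi> - 1 = n}"
      then have "saw G \<pi>" "hd \<pi> = v" using S W by auto
      with p show "set \<pi> \<subseteq> carrier G \<and> length \<pi> = Suc n \<and> hd \<pi> = v"
        by (cases \<pi>) (auto simp: saw_def)
    qed (use S in auto)
    also have "\<dots> \<le> max 1 (total_weight G \<phi>) ^ n"
      using total_weight_nonneg[OF phi] by (intro power_mono) auto
    also have "\<dots> \<le> max 1 (total_weight G \<phi>) ^ N" using n by (intro power_increasing) auto
    finally show "(\<Sum>\<pi>\<in>{\<pi> \<in> S. length \<pi> - 1 = n}. wt \<pi>) \<le> max 1 (total_weight G \<phi>) ^ N" .
  qed
  finally show "sum wt S \<le> real (N + 1) * max 1 (total_weight G \<phi>) ^ N" by simp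
qed

text \<open>The trivial bridge \<open>[v]\<close> has weight 1 and length 0; lower bounds on bridge
  weights are grown from it.\<close>

lemma one_le_brw:
  assumes "v \<in> carrier G" "0 < c"
  shows "1 \<le> brw v 0 c"
proof -
  have m: "[v] \<in> bridges_between G h l 0 c v"
    using assms by (simp add: bridges_between_def bridge_Cons_iff saw_def)
  have "sum wt {[v]} \<le> infsum wt (bridges_between G h l 0 c v)"
  proof (rule finite_sum_le_infsum[OF summable_bridges_between[OF is_group phi len assms(1)]])
    fix x assume "x \<in> bridges_between G h l 0 c v - {[v]}"
    then show "0 \<le> wt x" by (intro wt_nonneg bridge_carrier) (auto simp: bridges_between_def)
  qed (use m in auto)
  then show ?thesis by (simp add: walks_weight_def)
qed

lemma brw_le_sww: "brw \<one> m c \<le> sww m c"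
  by (rule walks_weight_mono[where v = \<one> and L = "m + c"])
    (auto simp: bridges_between_def saws_between_def bridge_def)

lemma walks_weight_nonneg:
  assumes "\<And>\<pi>. \<pi> \<in> W \<Longrightarrow> saw G \<pi>"
  shows "0 \<le> walks_weight G \<phi> W"
  unfolding walks_weight_def using assms by (intro infsum_nonneg wt_nonneg) (auto simp: saw_def)

lemma sww_nonneg: "0 \<le> sww m c"
  by (rule walks_weight_nonneg) (simp add: saws_between_def)

lemma brw_nonneg: "0 \<le> brw v m c"
  by (rule walks_weight_nonneg) (simp add: bridges_between_def bridge_def)

lemma sww_mono: "m' \<le> m \<Longrightarrow> m + c \<le> m' + c' \<Longrightarrow> sww m c \<le> sww m' c'"
  by (rule walks_weight_mono[where v = \<one> and L = "m' + c'"]) (auto simp: saws_between_def)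

lemma sww_add:
  assumes "0 \<le> c" "0 \<le> d"
  shows "sww m (c + d) = sww m c + sww (m + c) d"
proof -
  have "saws_between G l m (c + d) = saws_between G l m c \<union> saws_between G l (m + c) d"
    using assms by (auto simp: saws_between_def)
  moreover have "infsum wt (saws_between G l m c \<union> saws_between G l (m + c) d) =
      infsum wt (saws_between G l m c) + infsum wt (saws_between G l (m + c) d)"
    by (intro infsum_Un_disjoint summable_saws_between is_group phi len) (auto simp: saws_between_def)
  ultimately show ?thesis by (simp add: walks_weight_def)
qed

section \<open>Cutting self-avoiding walks at a prescribed length\<close>

lemma prefix_of_length:
  assumes "\<And>s. s \<in> supp G \<phi> \<Longrightarrow> l s \<le> c" "0 < c" "0 \<le> m"
  shows "\<pi> \<noteq> [] \<Longrightarrow> set \<pi> \<subseteq> carrier G \<Longrightarrow> 0 < wt \<pi> \<Longrightarrow> m \<le> wlen \<pi> \<Longrightarrow>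
    \<exists>p q. \<pi> = p @ q \<and> p \<noteq> [] \<and> m \<le> wlen p \<and> wlen p < m + c"
proof (induction \<pi> rule: rev_induct)
  case (snoc x \<pi>)
  show ?case
  proof (cases "\<pi> = []")
    case True
    then show ?thesis using snoc.prems assms(2,3) by (intro exI[of _ "[x]"] exI[of _ "[]"]) auto
  next
    case False
    have lc: "last \<pi> \<in> carrier G" "x \<in> carrier G" "set \<pi> \<subseteq> carrier G" using False snoc.prems(2) by auto
    define s where "s = inv (last \<pi>) \<otimes> x"
    have s: "s \<in> carrier G" using lc by (simp add: s_def)
    have w: "wt (\<pi> @ [x]) = wt \<pi> * \<phi> s" "wlen (\<pi> @ [x]) = wlen \<pi> + l s"
      by (simp_all add: walk_weight_append[OF False] walk_length_append[OF False] walk_weight_Cons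
          walk_length_Cons s_def)
    have "0 \<le> wt \<pi>" "0 \<le> \<phi> s" using wt_nonneg[OF lc(3)] phi s by (auto simp: step_weights_def)
    \<comment> \<open>Positive weight forces the last step into the support, where
      \<open>l s \<le> c\<close>; a prefix of length below \<open>m\<close> thus remains below
      \<open>m + c\<close> after one more step.\<close>
    then have pos: "0 < wt \<pi>" "0 < \<phi> s" using snoc.prems(3) by (auto simp: w zero_less_mult_iff)
    show ?thesis
    proof (cases "m \<le> wlen \<pi>")
      case True
      then obtain p q where "\<pi> = p @ q \<and> p \<noteq> [] \<and> m \<le> wlen p \<and> wlen p < m + c"
        using snoc.IH[OF False lc(3) pos(1)] by blast
      then show ?thesis by (intro exI[of _ p] exI[of _ "q @ [x]"]) simp
    next
      case less: False
      have "l s \<le> c" using pos(2) s by (intro assms(1)) (simp add: supp_def)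
      then show ?thesis using less snoc.prems(4) w(2)
        by (intro exI[of _ "\<pi> @ [x]"] exI[of _ "[]"]) auto
    qed
  qed
qed simp

text \<open>Translated by the inverse of the cut vertex, the second part is a self-avoiding walk
  from \<open>\<one>\<close>; no heights are involved, so any group element may translate.
  Subtracting a length known up to \<open>c\<close> from one known up to \<open>d\<close> leaves a
  window of width \<open>c + d\<close>.\<close>

lemma saws_split:
  assumes lc: "\<And>s. s \<in> supp G \<phi> \<Longrightarrow> l s \<le> c" and "0 < c" "0 \<le> m" "m \<le> t"
  shows "sww t d \<le> sww m c * sww (t - m - c) (c + d)"
proof -
  \<comment> \<open>The step bound \<open>c\<close> holds only on the support, so the cut is made
    for walks of positive weight; the others contribute 0.\<close>
  define Z where "Z = {\<pi> \<in> saws_between G l t d. 0 < wt \<pi>}"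
  let ?X = "saws_between G l m c" and ?Y = "saws_between G l (t - m - c) (c + d)"
  note summ = summable_saws_between[OF is_group phi len]
  have "\<exists>p q. \<pi> = p @ q \<and> p \<noteq> [] \<and> m \<le> wlen p \<and> wlen p < m + c" if "\<pi> \<in> Z" for \<pi>
    using that assms(4) by (intro prefix_of_length[OF lc assms(2,3)]) (auto simp: Z_def saws_between_def saw_def)
  then obtain p q where pq: "\<And>\<pi>. \<pi> \<in> Z \<Longrightarrow> \<pi> = p \<pi> @ q \<pi>" "\<And>\<pi>. \<pi> \<in> Z \<Longrightarrow> p \<pi> \<noteq> []"
    "\<And>\<pi>. \<pi> \<in> Z \<Longrightarrow> m \<le> wlen (p \<pi>)" "\<And>\<pi>. \<pi> \<in> Z \<Longrightarrow> wlen (p \<pi>) < m + c"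
    by metis
  define r where "r \<pi> = map ((\<otimes>) (inv (last (p \<pi>)))) (last (p \<pi>) # q \<pi>)" for \<pi>
  have saw: "saw G \<pi>" "hd \<pi> = \<one>" "t \<le> wlen \<pi>" "wlen \<pi> < t + d" if "\<pi> \<in> Z" for \<pi>
    using that by (auto simp: Z_def saws_between_def)
  have cp: "last (p \<pi>) \<in> carrier G" "set (last (p \<pi>) # q \<pi>) \<subseteq> carrier G" "distinct (last (p \<pi>) # q \<pi>)"
    "saw G (p \<pi>)" "hd (p \<pi>) = \<one>" if "\<pi> \<in> Z" for \<pi>
  proof -
    have *: "set (p \<pi> @ q \<pi>) \<subseteq> carrier G" "distinct (p \<pi> @ q \<pi>)" "hd (p \<pi> @ q \<pi>) = \<one>"
      using saw[OF that] pq(1)[OF that] by (auto simp: saw_def)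
    have l: "last (p \<pi>) \<notin> set (q \<pi>)"
      using *(2) last_in_set[OF pq(2)[OF that]] by (metis disjoint_iff distinct_append)
    show "last (p \<pi>) \<in> carrier G" "set (last (p \<pi>) # q \<pi>) \<subseteq> carrier G"
      "distinct (last (p \<pi>) # q \<pi>)" "saw G (p \<pi>)" "hd (p \<pi>) = \<one>"
      using * l pq(2)[OF that] by (auto simp: saw_def subset_iff)
  qed
  have "infsum wt (saws_between G l t d) = infsum wt Z"
  proof (rule infsum_cong_neutral)
    fix x assume "x \<in> saws_between G l t d - Z"
    then have "set x \<subseteq> carrier G" "\<not> 0 < wt x" by (auto simp: Z_def saws_between_def saw_def)
    then show "wt x = 0" using wt_nonneg[of x] by simp
  qed (auto simp: Z_def)
  also have "\<dots> \<le> infsum wt ?X * infsum wt ?Y"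
  proof (rule infsum_le_mult[where p = p and q = r])
    show "wt summable_on Z" by (rule summable_on_subset_banach[OF summ]) (auto simp: Z_def)
    show "wt summable_on ?X" "wt summable_on ?Y" by (rule summ)+
    show "0 \<le> wt x" if "x \<in> ?X" for x using that by (intro wt_nonneg) (auto simp: saws_between_def saw_def)
    show "0 \<le> wt x" if "x \<in> ?Y" for x using that by (intro wt_nonneg) (auto simp: saws_between_def saw_def)
    fix \<pi> assume z: "\<pi> \<in> Z"
    note e = pq(1)[OF z]
    have ic: "inv (last (p \<pi>)) \<in> carrier G" using cp(1)[OF z] by simp
    have wr: "wt (r \<pi>) = wt (last (p \<pi>) # q \<pi>)" "wlen (r \<pi>) = wlen (last (p \<pi>) # q \<pi>)"
      unfolding r_def using wt_translate[OF ic cp(2)[OF z]] length_translate[OF ic cp(2)[OF z]] .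
    have w: "wt \<pi> = wt (p \<pi>) * wt (r \<pi>)" "wlen \<pi> = wlen (p \<pi>) + wlen (r \<pi>)"
      using walk_weight_append[OF pq(2)[OF z], of G \<phi> "q \<pi>"] walk_length_append[OF pq(2)[OF z], of G l "q \<pi>"] e wr
      by simp_all
    have "saw G (r \<pi>)" unfolding r_def
      using cp(2,3)[OF z] by (intro saw_translate[OF ic]) (auto simp: saw_def)
    moreover have "hd (r \<pi>) = \<one>" using cp(1)[OF z] by (simp add: r_def)
    ultimately show "p \<pi> \<in> ?X \<and> r \<pi> \<in> ?Y \<and> wt \<pi> \<le> wt (p \<pi>) * wt (r \<pi>)"
      using w cp(4,5)[OF z] pq(3,4)[OF z] saw(3,4)[OF z] by (auto simp: saws_between_def)
  next
    show "inj_on (\<lambda>z. (p z, r z)) Z"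
    proof (rule inj_onI)
      fix x y assume xy: "x \<in> Z" "y \<in> Z" "(p x, r x) = (p y, r y)"
      have ic: "inv (last (p x)) \<in> carrier G" using cp(1)[OF xy(1)] by simp
      have "map ((\<otimes>) (inv (last (p x)))) (q x) = map ((\<otimes>) (inv (last (p x)))) (q y)"
        using xy(3) by (auto simp: r_def)
      moreover have "set (q x) \<union> set (q y) \<subseteq> carrier G" using cp(2)[OF xy(1)] cp(2)[OF xy(2)] by auto
      ultimately have "q x = q y" using inj_on_map_eq_map[OF inj_translate[OF ic]] by metis
      then show "x = y" using pq(1)[OF xy(1)] pq(1)[OF xy(2)] xy(3) by simp
    qed
  qed
  finally show ?thesis by (simp only: walks_weight_def)
qed

subsection \<open>The upper growth rate of self-avoiding walks\<close>

abbreviation "wmax \<equiv> max 1 (total_weight G \<phi>)"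

text \<open>The slope \<open>ln wmax / lmin\<close> in \<open>L\<close> is kept exact because it
  becomes the upper bound on the growth rate.\<close>

lemma ln_walks_weight_le:
  assumes "v \<in> carrier G" "W \<subseteq> {\<pi>. saw G \<pi> \<and> hd \<pi> = v \<and> wlen \<pi> < L}"
    and "0 < walks_weight G \<phi> W" "0 \<le> L"
  shows "ln (walks_weight G \<phi> W) \<le> ln (L / lmin + 1) + L / lmin * ln wmax"
proof -
  define N where "N = nat \<lfloor>L / lmin\<rfloor>"
  have "0 \<le> L / lmin" using assms(4) lmin_pos by simp
  then have N: "real N \<le> L / lmin" unfolding N_def by linarith
  have "0 \<le> ln wmax" by simp
  have "ln (walks_weight G \<phi> W) \<le> ln (real (N + 1) * wmax ^ N)"
    using walks_weight_le[OF assms(1,2)] assms(3) unfolding N_def[symmetric] by (subst ln_le_cancel_iff) auto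
  also have "\<dots> = ln (real (N + 1)) + real N * ln wmax"
    by (subst ln_mult) (auto simp: ln_realpow)
  also have "\<dots> \<le> ln (L / lmin + 1) + L / lmin * ln wmax"
    using N \<open>0 \<le> ln wmax\<close> by (intro add_mono mult_right_mono) auto
  finally show ?thesis .
qed

text \<open>A cruder form in the shape that the root lemmas require; the factor \<open>1 + c\<close>
  comes from \<open>m + c \<le> (1 + c) * (m + 1)\<close>.\<close>

lemma ln_walks_weight_le_linear:
  assumes "v \<in> carrier G" "W \<subseteq> {\<pi>. saw G \<pi> \<and> hd \<pi> = v \<and> wlen \<pi> < m + c}"
    and "0 < walks_weight G \<phi> W" "0 \<le> m" "0 \<le> c"
  shows "ln (walks_weight G \<phi> W) \<le> (1 + c) / lmin * (1 + ln wmax) * (m + 1)"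
proof -
  have q: "0 \<le> (m + c) / lmin" using assms lmin_pos by simp
  have "ln (walks_weight G \<phi> W) \<le> ln ((m + c) / lmin + 1) + (m + c) / lmin * ln wmax"
    using assms by (intro ln_walks_weight_le) auto
  also have "ln ((m + c) / lmin + 1) \<le> (m + c) / lmin"
    using ln_add_one_self_le_self[OF q] by (simp add: add.commute)
  also have "(m + c) / lmin + (m + c) / lmin * ln wmax = (m + c) / lmin * (1 + ln wmax)"
    by (simp add: algebra_simps)
  also have "\<dots> \<le> ((1 + c) * (m + 1)) / lmin * (1 + ln wmax)"
  proof -
    have "m + c \<le> (1 + c) * (m + 1)" using assms by (simp add: algebra_simps)
    then show ?thesis using lmin_pos by (intro mult_right_mono divide_right_mono) auto
  qed
  finally show ?thesis by (simp add: mult_ac)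
qed

lemma sww_sum_le: "0 \<le> c \<Longrightarrow> sww m (real K * c) \<le> (\<Sum>i<K. sww (m + real i * c) c)"
proof (induction K)
  case 0
  have "saws_between G l m 0 = {}" by (auto simp: saws_between_def)
  then show ?case by (simp add: walks_weight_def)
next
  case (Suc K)
  have "sww m (real K * c + c) = sww m (real K * c) + sww (m + real K * c) c"
    using Suc.prems by (intro sww_add) auto
  then show ?case using Suc by (simp add: algebra_simps)
qed

text \<open>For \<open>r > \<mu>\<close>, narrow windows eventually satisfy
  \<open>sww t c\<^sub>0 \<le> r powr t\<close>. The number \<open>K\<close> of them that cover a
  wide window is independent of \<open>m\<close>, so the wide weight is at most a constant times
  \<open>r powr m\<close>, and the constant disappears in the root.\<close>

lemma Limsup_sww_le:
  assumes "0 < c\<^sub>0" "0 < \<mu>"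
    and lim: "Limsup at_top (\<lambda>m::real. ereal (sww m c\<^sub>0 powr (1 / m))) = ereal \<mu>"
  shows "Limsup at_top (\<lambda>m::real. ereal (sww m c powr (1 / m))) \<le> ereal \<mu>"
proof (rule dense_ge)
  fix y :: ereal assume y: "ereal \<mu> < y"
  show "Limsup at_top (\<lambda>m::real. ereal (sww m c powr (1 / m))) \<le> y"
  proof (cases y)
    case (real r)
    then have r: "\<mu> < r" "0 < r" using y assms(2) by auto
    obtain T where T: "\<And>t. T \<le> t \<Longrightarrow> ereal (sww t c\<^sub>0 powr (1 / t)) < ereal r"
      using Limsup_lessD[of at_top "\<lambda>m. ereal (sww m c\<^sub>0 powr (1 / m))" "ereal r"] lim r
      by (auto simp: eventually_at_top_linorder)
    have le: "sww t c\<^sub>0 \<le> r powr t" if "max T 1 \<le> t" for t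
    proof -
      have "(sww t c\<^sub>0 powr (1 / t)) powr t \<le> r powr t"
        using T[of t] that by (intro powr_mono2) auto
      then show ?thesis using that sww_nonneg[of t c\<^sub>0] by (simp add: powr_powr)
    qed
    \<comment> \<open>The extra 1 keeps \<open>K\<close>, and hence \<open>C\<close>, positive for
      every real \<open>c\<close>.\<close>
    define K where "K = nat \<lceil>c / c\<^sub>0\<rceil> + 1"
    have "c / c\<^sub>0 \<le> real K" unfolding K_def by linarith
    then have K: "c \<le> real K * c\<^sub>0" using assms(1) by (simp add: pos_divide_le_eq)
    define C where "C = (\<Sum>i<K. r powr (real i * c\<^sub>0))"
    have "C > 0" unfolding C_def using r by (intro sum_pos) (auto simp: K_def)
    have bound: "sww m c powr (1 / m) \<le> C powr (1 / m) * r" if m: "max T 1 \<le> m" for m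
    proof -
      have "sww m c \<le> sww m (real K * c\<^sub>0)" using K by (intro sww_mono) auto
      also have "\<dots> \<le> (\<Sum>i<K. sww (m + real i * c\<^sub>0) c\<^sub>0)"
        using assms(1) by (intro sww_sum_le) auto
      also have "\<dots> \<le> (\<Sum>i<K. r powr (m + real i * c\<^sub>0))"
        using m assms(1) by (intro sum_mono le) (auto intro: add_increasing2)
      also have "\<dots> = C * r powr m"
        by (simp add: C_def powr_add sum_distrib_left mult.commute)
      finally have "sww m c powr (1 / m) \<le> (C * r powr m) powr (1 / m)"
        using m sww_nonneg by (intro powr_mono2) auto
      also have "\<dots> = C powr (1 / m) * r"
        using m r \<open>C > 0\<close> by (simp add: powr_mult powr_powr)
      finally show ?thesis .
    qed
    have "((\<lambda>m::real. C powr (1 / m) * r) \<longlongrightarrow> C powr 0 * r) at_top"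
      using \<open>C > 0\<close>
      by (intro tendsto_intros real_tendsto_divide_at_top[OF tendsto_const filterlim_ident]) auto
    then have "((\<lambda>m::real. ereal (C powr (1 / m) * r)) \<longlongrightarrow> ereal r) at_top"
      using \<open>C > 0\<close> by simp
    then have "Limsup at_top (\<lambda>m::real. ereal (C powr (1 / m) * r)) = ereal r"
      by (intro lim_imp_Limsup) auto
    moreover have "eventually (\<lambda>m. ereal (sww m c powr (1 / m)) \<le> ereal (C powr (1 / m) * r)) at_top"
      using eventually_ge_at_top[of "max T 1"] by eventually_elim (simp only: ereal_less_eq bound)
    note Limsup_mono[OF this]
    ultimately show ?thesis by (simp only: real)
  qed (use y in auto)
qed

text \<open>The logarithm of the number of possible step counts is negligible after division by
  \<open>m\<close>; only the slope \<open>ln wmax / lmin\<close> remains.\<close>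

lemma Limsup_sww_le_max:
  assumes "0 < c" and pos: "\<And>m. 0 \<le> m \<Longrightarrow> 0 < sww m c"
  shows "Limsup at_top (\<lambda>m::real. ereal (sww m c powr (1 / m)))
    \<le> ereal (max 1 (total_weight G \<phi> powr (1 / min_length G l)))"
proof -
  define U where "U m = exp ((ln ((m + c) / lmin + 1) + (m + c) / lmin * ln wmax) / m)" for m
  have bound: "sww m c powr (1 / m) \<le> U m" if "1 \<le> m" for m
  proof -
    have "ln (sww m c) \<le> ln ((m + c) / lmin + 1) + (m + c) / lmin * ln wmax"
      using that pos[of m] assms(1)
      by (intro ln_walks_weight_le[OF one_closed]) (auto simp: saws_between_def)
    then have "ln (sww m c) / m \<le> (ln ((m + c) / lmin + 1) + (m + c) / lmin * ln wmax) / m"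
      using that by (intro divide_right_mono) auto
    then show ?thesis using pos[of m] that by (simp add: U_def powr_def)
  qed
  have "((\<lambda>m. ln (m / a + 1) / m) \<longlongrightarrow> 0) at_top" if "0 < a" for a :: real
    using that by real_asymp
  from this[OF lmin_pos] have "((\<lambda>m. ln (m / lmin + 1) / m) \<longlongrightarrow> 0) at_top" .
  moreover have "((\<lambda>m. (ln wmax / lmin * m) / m) \<longlongrightarrow> ln wmax / lmin) at_top"
    by (rule Lim_transform_eventually[OF tendsto_const])
      (use eventually_gt_at_top[of 0] in \<open>eventually_elim, simp\<close>)
  ultimately have "((\<lambda>m. ln (m / lmin + 1) / m + (ln wmax / lmin * m) / m) \<longlongrightarrow> 0 + ln wmax / lmin) at_top"
    by (rule tendsto_add)
  then have "((\<lambda>m. (ln (m / lmin + 1) + ln wmax / lmin * m) / m) \<longlongrightarrow> ln wmax / lmin) at_top"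
    by (simp add: add_divide_distrib)
  from tendsto_quotient_shift[OF this, of c 0]
  have "(U \<longlongrightarrow> exp (ln wmax / lmin)) at_top"
    unfolding U_def by (intro tendsto_exp) (simp add: mult.commute)
  also have "exp (ln wmax / lmin) = wmax powr (1 / lmin)" by (simp add: powr_def)
  \<comment> \<open>Raising to the positive power \<open>1 / lmin\<close> is monotone and fixes 1,
    so it commutes with the maximum.\<close>
  also have "\<dots> = max 1 (total_weight G \<phi> powr (1 / lmin))"
    using lmin_pos total_weight_nonneg[OF phi]
    by (cases "total_weight G \<phi> \<ge> 1") (auto simp: max_def ge_one_powr_ge_zero powr_le1 intro!: antisym)
  finally have "Limsup at_top (\<lambda>m. ereal (U m)) = ereal (max 1 (total_weight G \<phi> powr (1 / lmin)))"
    by (intro lim_imp_Limsup) (simp_all del: ereal_max)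
  moreover have "eventually (\<lambda>m. ereal (sww m c powr (1 / m)) \<le> ereal (U m)) at_top"
    using eventually_ge_at_top[of 1] by eventually_elim (simp only: ereal_less_eq bound)
  note Limsup_mono[OF this]
  ultimately show ?thesis by (simp only:)
qed

end

section \<open>Growth rates\<close>

text \<open>The constants of \<open>bridges_extend\<close> are fixed once, so that a single
  threshold serves all start vertices and all later comparisons.\<close>

locale extendable_height_group = height_group +
  fixes c\<^sub>0 \<kappa> :: real
  assumes c0_pos: "0 < c\<^sub>0" and kappa: "0 < \<kappa>" "\<kappa> \<le> 1"
    and extend: "\<And>c c1 v m T n. c\<^sub>0 \<le> c \<Longrightarrow> 0 < c1 \<Longrightarrow> v \<in> carrier G \<Longrightarrow> m + c1 \<le> T + c \<Longrightarrow>
      T - real n * lmin \<le> m \<Longrightarrow> brw v m c1 \<le> (1 / \<kappa>) ^ n * (c1 / lmin + 1) * brw v T c"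
begin

text \<open>Extending the trivial bridge from the window at 0 to the window at \<open>m\<close>
  takes about \<open>m / lmin\<close> continuations, each costing a factor \<open>\<kappa>\<close>.
  Hence no window has weight 0, and the logarithm decreases at most linearly.\<close>

lemma brw_bounds:
  assumes "c\<^sub>0 \<le> c"
  shows "\<exists>B. \<forall>v\<in>carrier G. \<forall>m\<ge>0. 0 < brw v m c \<and> - (B * (m + 1)) \<le> ln (brw v m c)"
proof -
  define B where "B = (1 / lmin + 1) * ln (1 / \<kappa>) + ln (c / lmin + 1)"
  have c: "0 < c" using assms c0_pos by simp
  have K1: "1 \<le> 1 / \<kappa>" using kappa by simp
  have c1: "1 \<le> c / lmin + 1" using c lmin_pos by simp
  have "0 < brw v m c \<and> - (B * (m + 1)) \<le> ln (brw v m c)" if v: "v \<in> carrier G" and m: "0 \<le> m" for v m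
  proof -
    define n where "n = nat \<lceil>m / lmin\<rceil>"
    have q: "0 \<le> m / lmin" using m lmin_pos by simp
    then have n: "m / lmin \<le> real n" "real n \<le> m / lmin + 1" unfolding n_def by linarith+
    have "m - real n * lmin \<le> 0" using n(1) lmin_pos by (simp add: pos_divide_le_eq)
    then have "brw v 0 c \<le> (1 / \<kappa>) ^ n * (c / lmin + 1) * brw v m c"
      using assms c v m by (intro extend) auto
    then have le: "1 \<le> (1 / \<kappa>) ^ n * (c / lmin + 1) * brw v m c" using one_le_brw[OF v c] by simp
    have Kn: "0 < (1 / \<kappa>) ^ n" using kappa by simp
    have pos: "0 < brw v m c" using le brw_nonneg[of m c v] by (cases "brw v m c = 0") auto
    have "0 \<le> ln ((1 / \<kappa>) ^ n * (c / lmin + 1) * brw v m c)" using le by simp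
    also have "\<dots> = real n * ln (1 / \<kappa>) + ln (c / lmin + 1) + ln (brw v m c)"
      using pos Kn c1 kappa(1) by (simp add: ln_mult ln_realpow)
    also have "\<dots> \<le> (1 / lmin + 1) * ln (1 / \<kappa>) * (m + 1) + ln (c / lmin + 1) * (m + 1) + ln (brw v m c)"
    proof -
      have "(1 / lmin + 1) * (m + 1) = m / lmin + 1 + (1 / lmin + m)"
        by (simp add: algebra_simps add_divide_distrib)
      moreover have "0 \<le> 1 / lmin + m" using m lmin_pos by simp
      ultimately have "real n \<le> (1 / lmin + 1) * (m + 1)" using n(2) by simp
      then have "real n * ln (1 / \<kappa>) \<le> (1 / lmin + 1) * (m + 1) * ln (1 / \<kappa>)"
        using K1 by (intro mult_right_mono) auto
      moreover have "ln (c / lmin + 1) * 1 \<le> ln (c / lmin + 1) * (m + 1)"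
        using c1 m by (intro mult_left_mono) auto
      ultimately show ?thesis by (simp add: mult_ac)
    qed
    finally show ?thesis using pos by (simp add: B_def algebra_simps)
  qed
  then show ?thesis by blast
qed

lemma brw_pos: "c\<^sub>0 \<le> c \<Longrightarrow> v \<in> carrier G \<Longrightarrow> 0 \<le> m \<Longrightarrow> 0 < brw v m c"
  using brw_bounds by blast

lemma sww_pos: "c\<^sub>0 \<le> c \<Longrightarrow> 0 \<le> m \<Longrightarrow> 0 < sww m c"
  using brw_pos[OF _ one_closed] brw_le_sww by (meson less_le_trans)

lemma brw_limit:
  assumes c: "c\<^sub>0 \<le> c" and v: "v \<in> carrier G"
  shows "\<exists>\<beta>>0. ((\<lambda>m. brw v m c powr (1 / m)) \<longlongrightarrow> \<beta>) at_top"
proof -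
  obtain \<kappa>' L where \<kappa>': "0 < \<kappa>'" "0 < L" and join: "\<And>u m n c1 c2. u \<in> carrier G \<Longrightarrow> 0 < c1 \<Longrightarrow> 0 < c2 \<Longrightarrow>
      brw u m c1 * brw v n c2 \<le> 1 / \<kappa>' * (c1 / lmin + 1) * brw u (m + n) (c1 + c2 + L)"
    using bridges_join[OF v] by blast
  obtain B where B: "\<And>m. 0 \<le> m \<Longrightarrow> - (B * (m + 1)) \<le> ln (brw v m c)"
    using brw_bounds[OF c] v by blast
  have cp: "0 < c" using c c0_pos by simp
  \<comment> \<open>Joining two windows of width \<open>c\<close> gives width
    \<open>c + c + L\<close>; with this shift the window of width \<open>c\<close> at
    \<open>x + y + D\<close> has the same upper end.\<close>
  define D where "D = c + L"
  define n where "n = nat \<lceil>D / lmin\<rceil>"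
  have "D / lmin \<le> real n" unfolding n_def by linarith
  then have n: "D \<le> real n * lmin" using lmin_pos by (simp add: pos_divide_le_eq)
  define C1 where "C1 = 1 / \<kappa>' * (c / lmin + 1)"
  define C2 where "C2 = (1 / \<kappa>) ^ n * ((c + c + L) / lmin + 1)"
  have Cp: "0 < C1" "0 < C2" unfolding C1_def C2_def using \<kappa>' kappa lmin_pos cp
    by (auto intro!: mult_pos_pos add_pos_pos divide_pos_pos)
  define A where "A = max B ((1 + c) / lmin * (1 + ln wmax))"
  show ?thesis
  proof (rule supermultiplicative_root_converges[of D "C1 * C2"])
    show "0 < D" using cp \<kappa>' by (simp add: D_def)
    show "0 < C1 * C2" using Cp by simp
    show "0 < brw v x c" if "0 \<le> x" for x using brw_pos[OF c v that] .
    show "brw v x c * brw v y c \<le> C1 * C2 * brw v (x + y + D) c" if "0 \<le> x" "0 \<le> y" for x y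
    proof -
      have "brw v x c * brw v y c \<le> C1 * brw v (x + y) (c + c + L)"
        unfolding C1_def by (rule join[OF v cp cp])
      also have "brw v (x + y) (c + c + L) \<le> C2 * brw v (x + y + D) c"
        unfolding C2_def using cp \<kappa>' n by (intro extend c v) (auto simp: D_def)
      finally show ?thesis using Cp by (simp add: mult.assoc)
    qed
    show "\<bar>ln (brw v x c)\<bar> \<le> A * (x + 1)" if x: "0 \<le> x" for x
    proof -
      have "ln (brw v x c) \<le> (1 + c) / lmin * (1 + ln wmax) * (x + 1)"
        using x cp brw_pos[OF c v x] v
        by (intro ln_walks_weight_le_linear) (auto simp: bridges_between_def bridge_def)
      also have "\<dots> \<le> A * (x + 1)" using x by (intro mult_right_mono) (auto simp: A_def)
      finally have "ln (brw v x c) \<le> A * (x + 1)" .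
      moreover have "B * (x + 1) \<le> A * (x + 1)" using x by (intro mult_right_mono) (auto simp: A_def)
      ultimately show ?thesis using B[OF x] by simp
    qed
  qed
qed

text \<open>Bridges from \<open>u\<close> in the window at 0 weigh at least 1, so prefixing them to
  bridges from \<open>v\<close> loses at most a constant; extension then adjusts the width. Changes
  of start vertex and of width are thus handled together.\<close>

lemma brw_compare:
  assumes "c\<^sub>0 \<le> c" "c\<^sub>0 \<le> d" "u \<in> carrier G" "v \<in> carrier G"
  shows "\<exists>C>0. \<exists>D\<ge>0. \<forall>x\<ge>0. brw v x d \<le> C * brw u (x + D) c"
proof -
  obtain \<kappa>' L where \<kappa>': "0 < \<kappa>'" "0 < L" and join: "\<And>u m n c1 c2. u \<in> carrier G \<Longrightarrow> 0 < c1 \<Longrightarrow> 0 < c2 \<Longrightarrow>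
      brw u m c1 * brw v n c2 \<le> 1 / \<kappa>' * (c1 / lmin + 1) * brw u (m + n) (c1 + c2 + L)"
    using bridges_join[OF assms(4)] by blast
  have dp: "0 < d" using assms c0_pos by simp
  define D where "D = c\<^sub>0 + d + L"
  define n where "n = nat \<lceil>D / lmin\<rceil>"
  have "D / lmin \<le> real n" unfolding n_def by linarith
  then have n: "D \<le> real n * lmin" using lmin_pos by (simp add: pos_divide_le_eq)
  define C1 where "C1 = 1 / \<kappa>' * (c\<^sub>0 / lmin + 1)"
  define C2 where "C2 = (1 / \<kappa>) ^ n * ((c\<^sub>0 + d + L) / lmin + 1)"
  have Cp: "0 < C1" "0 < C2" unfolding C1_def C2_def using \<kappa>' kappa lmin_pos dp c0_pos
    by (auto intro!: mult_pos_pos add_pos_pos divide_pos_pos)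
  have "brw v x d \<le> C1 * C2 * brw u (x + D) c" if "0 \<le> x" for x
  proof -
    have "1 * brw v x d \<le> brw u 0 c\<^sub>0 * brw v x d"
      by (intro mult_right_mono one_le_brw assms c0_pos brw_nonneg)
    also have "\<dots> \<le> C1 * brw u (0 + x) (c\<^sub>0 + d + L)"
      unfolding C1_def by (rule join[OF assms(3) c0_pos dp])
    also have "brw u (0 + x) (c\<^sub>0 + d + L) \<le> C2 * brw u (x + D) c"
      unfolding C2_def using c0_pos dp \<kappa>' n assms(1) by (intro extend assms) (auto simp: D_def)
    finally show ?thesis using Cp by (simp add: mult.assoc)
  qed
  moreover have "0 \<le> D" using c0_pos dp \<kappa>' by (simp add: D_def)
  ultimately show ?thesis using Cp by (meson mult_pos_pos)
qed

lemma brw_limit_uniform: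
  "\<exists>\<beta>>0. \<forall>c\<ge>c\<^sub>0. \<forall>v\<in>carrier G. ((\<lambda>m. brw v m c powr (1 / m)) \<longlongrightarrow> \<beta>) at_top"
proof -
  obtain \<beta> where \<beta>: "\<beta> > 0" "((\<lambda>m. brw \<one> m c\<^sub>0 powr (1 / m)) \<longlongrightarrow> \<beta>) at_top"
    using brw_limit[OF order_refl one_closed] by blast
  have "((\<lambda>m. brw v m c powr (1 / m)) \<longlongrightarrow> \<beta>) at_top" if c: "c\<^sub>0 \<le> c" and v: "v \<in> carrier G" for c v
  proof -
    obtain C D where C: "0 < C" "0 \<le> D" "\<And>x. 0 \<le> x \<Longrightarrow> brw \<one> x c\<^sub>0 \<le> C * brw v (x + D) c"
      using brw_compare[OF c order_refl v one_closed] by blast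
    obtain C' D' where C': "0 < C'" "0 \<le> D'" "\<And>x. 0 \<le> x \<Longrightarrow> brw v x c \<le> C' * brw \<one> (x + D') c\<^sub>0"
      using brw_compare[OF order_refl c one_closed v] by blast
    show ?thesis
      by (rule comparable_root_tendsto[OF C(1) C'(1) C(2) C'(2) \<beta>(1) _ _ C(3) C'(3) \<beta>(2)])
        (use brw_pos[OF order_refl one_closed] brw_pos[OF c v] in auto)
  qed
  then show ?thesis using \<beta>(1) by blast
qed

text \<open>The shift by \<open>c\<close> makes the second factor of the split start exactly at
  \<open>y\<close>, but with width \<open>c + c\<close>. Its upper half is split again at
  \<open>y\<close>, which reduces it to width \<open>c\<close> at the price of the constant
  \<open>sww 0 (c + c)\<close>.\<close>

lemma sww_limit:
  assumes c: "c\<^sub>0 \<le> c" and lc: "\<And>s. s \<in> supp G \<phi> \<Longrightarrow> l s \<le> c"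
  shows "\<exists>\<mu>>0. ((\<lambda>m. sww m c powr (1 / m)) \<longlongrightarrow> \<mu>) at_top"
proof -
  have cp: "0 < c" using c c0_pos by simp
  obtain B where B: "\<And>m. 0 \<le> m \<Longrightarrow> - (B * (m + 1)) \<le> ln (brw \<one> m c)"
    using brw_bounds[OF c] one_closed by blast
  define A where "A = max B ((1 + c) / lmin * (1 + ln wmax))"
  show ?thesis
  proof (rule submultiplicative_root_converges[of c "1 + sww 0 (c + c)"])
    show "0 < 1 + sww 0 (c + c)" using sww_nonneg[of 0 "c + c"] by simp
    show "0 < sww x c" if "0 \<le> x" for x using sww_pos[OF c that] .
    show "sww (x + y + c) c \<le> (1 + sww 0 (c + c)) * sww x c * sww y c" if xy: "0 \<le> x" "0 \<le> y" for x y
    proof -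
      have "sww (x + y + c) c \<le> sww x c * sww (x + y + c - x - c) (c + c)"
        using xy cp by (intro saws_split[OF lc]) auto
      then have 1: "sww (x + y + c) c \<le> sww x c * sww y (c + c)" by simp
      have "sww (y + c) c \<le> sww y c * sww (y + c - y - c) (c + c)"
        using xy cp by (intro saws_split[OF lc]) auto
      then have "sww y (c + c) \<le> sww y c + sww y c * sww 0 (c + c)"
        using sww_add[of c c y] cp by simp
      then have "sww x c * sww y (c + c) \<le> sww x c * (sww y c + sww y c * sww 0 (c + c))"
        by (intro mult_left_mono sww_nonneg)
      with 1 show ?thesis by (simp add: algebra_simps)
    qed
    show "\<bar>ln (sww x c)\<bar> \<le> A * (x + 1)" if x: "0 \<le> x" for x
    proof -
      have "ln (sww x c) \<le> (1 + c) / lmin * (1 + ln wmax) * (x + 1)"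
        using x cp sww_pos[OF c x]
        by (intro ln_walks_weight_le_linear[OF one_closed]) (auto simp: saws_between_def)
      also have "\<dots> \<le> A * (x + 1)" using x by (intro mult_right_mono) (auto simp: A_def)
      finally have "ln (sww x c) \<le> A * (x + 1)" .
      moreover have "B * (x + 1) \<le> A * (x + 1)" using x by (intro mult_right_mono) (auto simp: A_def)
      moreover have "ln (brw \<one> x c) \<le> ln (sww x c)"
        using brw_le_sww brw_pos[OF c one_closed x] by (simp add: sww_pos[OF c x])
      ultimately show ?thesis using B[OF x] by simp
    qed
  qed (rule cp)
qed

text \<open>The bounds from bridges and from counting steps first make the upper limit at
  \<open>c\<^sub>0\<close> a positive real. For larger \<open>c\<close>, one inequality is
  monotonicity in the window, the other the covering estimate \<open>Limsup_sww_le\<close>.\<close>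

lemma sww_Limsup:
  assumes \<beta>: "0 < \<beta>" "\<And>c. c\<^sub>0 \<le> c \<Longrightarrow> ((\<lambda>m. brw \<one> m c powr (1 / m)) \<longlongrightarrow> \<beta>) at_top"
  shows "\<exists>\<mu>\<ge>\<beta>. \<mu> \<le> max 1 (total_weight G \<phi> powr (1 / min_length G l)) \<and>
    (\<forall>c\<ge>c\<^sub>0. Limsup at_top (\<lambda>m::real. ereal (sww m c powr (1 / m))) = ereal \<mu>)"
proof -
  define M where "M c = Limsup at_top (\<lambda>m::real. ereal (sww m c powr (1 / m)))" for c
  define R where "R = max 1 (total_weight G \<phi> powr (1 / min_length G l))"
  have low: "ereal \<beta> \<le> M c\<^sub>0"
  proof -
    have "ereal \<beta> = Limsup at_top (\<lambda>m::real. ereal (brw \<one> m c\<^sub>0 powr (1 / m)))"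
      using \<beta>(2)[OF order_refl] by (intro lim_imp_Limsup[symmetric]) auto
    also have "\<dots> \<le> M c\<^sub>0"
      unfolding M_def
    proof (rule Limsup_mono)
      show "eventually (\<lambda>m. ereal (brw \<one> m c\<^sub>0 powr (1 / m)) \<le> ereal (sww m c\<^sub>0 powr (1 / m))) at_top"
        using eventually_ge_at_top[of 0]
        by eventually_elim (simp add: powr_mono2 brw_le_sww brw_nonneg)
    qed
    finally show ?thesis .
  qed
  have up: "M c\<^sub>0 \<le> ereal R"
    unfolding M_def R_def by (rule Limsup_sww_le_max[OF c0_pos sww_pos[OF order_refl]])
  obtain \<mu> where \<mu>: "M c\<^sub>0 = ereal \<mu>" using low up by (cases "M c\<^sub>0") auto
  then have le: "\<beta> \<le> \<mu>" "\<mu> \<le> R" using low up by auto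
  have "M c = ereal \<mu>" if c: "c\<^sub>0 \<le> c" for c
  proof (rule antisym)
    show "M c \<le> ereal \<mu>"
      unfolding M_def using \<mu> le \<beta>(1) by (intro Limsup_sww_le[OF c0_pos]) (auto simp: M_def)
    have "M c\<^sub>0 \<le> M c"
      unfolding M_def
    proof (rule Limsup_mono)
      show "eventually (\<lambda>m. ereal (sww m c\<^sub>0 powr (1 / m)) \<le> ereal (sww m c powr (1 / m))) at_top"
        using eventually_ge_at_top[of 0]
        by eventually_elim (use c in \<open>simp add: powr_mono2 sww_mono sww_nonneg\<close>)
    qed
    then show "ereal \<mu> \<le> M c" by (simp add: \<mu>)
  qed
  then show ?thesis using le unfolding M_def R_def by blast
qed

end

section \<open>A common threshold for the window width and identification of the limits\<close>

theorem theorem3p7: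
  fixes \<Gamma> :: "('a, 'b) monoid_scheme"
    and H :: "'a set"
    and F h\<^sub>F :: "'a \<Rightarrow> int"
    and \<phi> l :: "'a \<Rightarrow> real"
  assumes "finitely_generated_group \<Gamma>"
    and "virtually_indicable \<Gamma> H F"
    and "\<phi> \<in> step_weights \<Gamma>"
    and "l \<in> step_lengths \<Gamma>"
    and "strong_graph_height_function \<Gamma> \<phi> h\<^sub>F H"
  shows "\<exists>\<mu> \<beta> c\<^sub>0 :: real. c\<^sub>0 > 0 \<and>
    (\<forall>c\<ge>c\<^sub>0.
       Limsup at_top
         (\<lambda>m::real. ereal (walks_weight \<Gamma> \<phi> (saws_between \<Gamma> l m c) powr (1 / m))) = ereal \<mu> \<and>
       (\<forall>v\<in>carrier \<Gamma>.
         ((\<lambda>m::real. walks_weight \<Gamma> \<phi> (bridges_between \<Gamma> h\<^sub>F l m c v) powr (1 / m))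
           \<longlongrightarrow> \<beta>) at_top)) \<and>
    (bdd_above (l ` supp \<Gamma> \<phi>) \<longrightarrow>
       (\<forall>c\<ge>c\<^sub>0.
         ((\<lambda>m::real. walks_weight \<Gamma> \<phi> (saws_between \<Gamma> l m c) powr (1 / m)) \<longlongrightarrow> \<mu>) at_top)) \<and>
    0 < \<beta> \<and> \<beta> \<le> \<mu> \<and> \<mu> \<le> max 1 (total_weight \<Gamma> \<phi> powr (1 / min_length \<Gamma> l))"
proof -
  interpret group \<Gamma> using assms(1) by (simp add: finitely_generated_group_def)
  interpret height_group \<Gamma> \<phi> l h\<^sub>F H
    using assms(3-5) by unfold_locales
  obtain c1 \<kappa> where "0 < c1" "0 < \<kappa>" "\<kappa> \<le> 1" "\<forall>c\<ge>c1. \<forall>c1>0. \<forall>v\<in>carrier \<Gamma>. \<forall>m T n.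
     m + c1 \<le> T + c \<longrightarrow> T - real n * lmin \<le> m \<longrightarrow>
     brw v m c1 \<le> (1 / \<kappa>) ^ n * (c1 / lmin + 1) * brw v T c"
    using bridges_extend by blast
  then interpret extendable_height_group \<Gamma> \<phi> l h\<^sub>F H c1 \<kappa>
    by unfold_locales blast+
  obtain \<beta> where \<beta>: "0 < \<beta>"
    "\<And>c v. c1 \<le> c \<Longrightarrow> v \<in> carrier \<Gamma> \<Longrightarrow> ((\<lambda>m. brw v m c powr (1 / m)) \<longlongrightarrow> \<beta>) at_top"
    using brw_limit_uniform by blast
  obtain \<mu> where \<mu>: "\<beta> \<le> \<mu>" "\<mu> \<le> max 1 (total_weight \<Gamma> \<phi> powr (1 / min_length \<Gamma> l))"
    "\<And>c. c1 \<le> c \<Longrightarrow> Limsup at_top (\<lambda>m::real. ereal (sww m c powr (1 / m))) = ereal \<mu>"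
    using sww_Limsup[OF \<beta>(1) \<beta>(2)[OF _ one_closed]] by blast
  \<comment> \<open>For part (b) no step of positive weight may exceed the window width, so the
    threshold is raised to the supremum of these step lengths when they are bounded; otherwise
    \<open>Sup\<close> would carry no information.\<close>
  define c2 where "c2 = (if bdd_above (l ` supp \<Gamma> \<phi>) then max c1 (Sup (l ` supp \<Gamma> \<phi>)) else c1)"
  have c2: "c1 \<le> c2" by (simp add: c2_def)
  have lim: "((\<lambda>m. sww m c powr (1 / m)) \<longlongrightarrow> \<mu>) at_top"
    if bdd: "bdd_above (l ` supp \<Gamma> \<phi>)" and c: "c2 \<le> c" for c
  proof -
    have "l s \<le> c" if "s \<in> supp \<Gamma> \<phi>" for s
      using cSup_upper[OF imageI[OF that] bdd] bdd c by (simp add: c2_def)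
    then obtain \<mu>' where \<mu>': "((\<lambda>m. sww m c powr (1 / m)) \<longlongrightarrow> \<mu>') at_top"
      using sww_limit[of c] c c2 by (meson order_trans)
    \<comment> \<open>The limit just obtained could depend on \<open>c\<close>; it equals the upper
      limit, which is \<open>\<mu>\<close> for every admissible width.\<close>
    then have "((\<lambda>m. ereal (sww m c powr (1 / m))) \<longlongrightarrow> ereal \<mu>') at_top" by simp
    then have "Limsup at_top (\<lambda>m. ereal (sww m c powr (1 / m))) = ereal \<mu>'"
      by (intro lim_imp_Limsup) auto
    then show ?thesis using \<mu>' \<mu>(3)[of c] c c2 by simp
  qed
  show ?thesis
  proof (rule exI[of _ \<mu>], rule exI[of _ \<beta>], rule exI[of _ c2], intro conjI allI impI ballI)
    show "0 < c2" using c0_pos c2 by simp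
  qed (use \<beta> \<mu> lim c2 in \<open>auto dest: order_trans[OF c2]\<close>)
qed

end
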